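(* Let $\delta>0$. Algorithm 1 described in the context, run with tolerance $\delta$, converges to a $\delta$-optimal solution in a finite number of iterations; that is, after finitely many iterations its stopping criterion $\overline{\theta}^k-\underline{\theta}^k\le\delta$ is satisfied.
   Context: Setting. Fix a vector $x$. Let $\mathbf d\ge 2$ be an integer (number of stages), $\mathcal M$ a finite set of states and $\Omega$ a finite set of scenarios, with $\pi^\omega=1/|\Omega|$ for every $\omega\in\Omega$. Let $\pi^m_1\ge 0$ ($m\in\mathcal M$) with $\sum_m \pi^m_1=1$ and, for $d=2,\dots,\mathbf d$, $\pi^{lm}_d\ge 0$ ($l,m\in\mathcal M$) with $\sum_{m\in\mathcal M}\pi^{lm}_d=1$ for each $l$. For $d=1,\dots,\mathbf d$ let $c_d$ be a cost vector, $A_d,C_d$ matrices, $(x,b)\mapsto x^\top B_d b$ a given bilinear map into the right-hand-side space, and $\mathcal Y_d$ a set, described by linear constraints (possibly linking scenarios), of stage-$d$ decisions $y_d=(y^\omega_d)_{\omega\in\Omega}$; $\mathcal Y^\omega_d$ denotes the (convex, compact) set of admissible single-scenario components $y^\omega_d$. Given data vectors $b^{m\omega}_1$ and $b^{lm\omega}_d$ ($d\ge 2$), define for single-scenario vectors $y_{d-1}$: $V^{lm}_{\mathbf d}(y_{\mathbf d-1})=\min_{y_{\mathbf d}\in\mathcal Y_{\mathbf d}}\sum_{\omega}\pi^\omega c_{\mathbf d}^\top y^\omega_{\mathbf d}$ s.t. $A_{\mathbf d}y^\omega_{\mathbf d}\le x^\top B_{\mathbf d}b^{lm\omega}_{\mathbf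 d}+C_{\mathbf d}y_{\mathbf d-1}$ for all $\omega$; for $2\le d\le \mathbf d-1$: $V^{lm}_d(y_{d-1})=\min_{y_d\in\mathcal Y_d}\sum_\omega\pi^\omega\big(c_d^\top y^\omega_d+\sum_{n\in\mathcal M}\pi^{mn}_{d+1}V^{mn}_{d+1}(y^\omega_d)\big)$ s.t. $A_dy^\omega_d\le x^\top B_d b^{lm\omega}_d+C_dy_{d-1}$ for all $\omega$; $V^m_1=\min_{y_1\in\mathcal Y_1}\sum_\omega\pi^\omega\big(c_1^\top y^\omega_1+\sum_n\pi^{mn}_2V^{mn}_2(y^\omega_1)\big)$ s.t. $A_1y^\omega_1\le x^\top B_1b^{m\omega}_1$ for all $\omega$; and $g(x)=\sum_m\pi^m_1V^m_1$. Standing assumptions: relatively complete recourse (all these problems are feasible with finite optimal value for every admissible argument); bounded subgradients: there is a constant $\mathrm M_y>0$ with $\|\sigma\|\le \mathrm M_y$ for every subgradient $\sigma$ of every $V^{lm}_d$ with respect to its argument. $\|\cdot\|$ is the 1-norm. Approximating problems. For $d\in\{1,\dots,\mathbf d-1\}$, $l,m\in\mathcal M$ (for $d=1$ the index $l$ and argument $y_0$ are absent and the constraint is $A_1y^\omega_1\le x^\top B_1b^{m\omega}_1$), problem $\mathrm{LP}^{lm}_d(y_{d-1})$ carries, for each $n\in\mathcal M$, a finite collection of triples $(\underline\theta_s,\underline\sigma_s,y_s)$ and is: minimise over $y_d\in\mathcal Y_d$ and $\underline\vartheta^{\omega n}$ the objective $\sum_\omega\pi^\omega\big(c_d^\top y^\omega_d+\sum_n\pi^{mn}_{d+1}\underline\vartheta^{\omega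 n}\big)$ subject to $A_dy^\omega_d\le x^\top B_db^{lm\omega}_d+C_dy_{d-1}$ for all $\omega$ and $\underline\vartheta^{\omega n}\ge\underline\theta_s+\underline\sigma_s^\top(y^\omega_d-y_s)$ for all $\omega$, $n$ and all triples $s$ of the collection for $n$. Problem $\mathrm{UP}^{lm}_d(y_{d-1})$ carries, for each $n$, a finite collection of pairs $(\overline\theta_s,y_s)$ and is: minimise over $y_d\in\mathcal Y_d$, $\overline\vartheta^{\omega n}$, $\gamma^{\omega n}$, $\mu^{\omega n}_s\ge0$ the objective $\sum_\omega\pi^\omega\big(c_d^\top y^\omega_d+\sum_n\pi^{mn}_{d+1}\overline\vartheta^{\omega n}\big)$ subject to the same constraints $A_dy^\omega_d\le\dots$, and $\overline\vartheta^{\omega n}\ge\sum_s\mu^{\omega n}_s\overline\theta_s+\mathrm M_y\|\gamma^{\omega n}\|$, $\sum_s\mu^{\omega n}_sy_s=y^\omega_d+\gamma^{\omega n}$, $\sum_s\mu^{\omega n}_s=1$. $\mathrm{UP}^{lm}_d(y_{d-1},\tilde y)$ is $\mathrm{UP}^{lm}_d(y_{d-1})$ with the extra constraint $y_d=\tilde y$. For $d=\mathbf d$, both $\mathrm{LP}^{lm}_{\mathbf d}(y_{\mathbf d-1})$ and $\mathrm{UP}^{lm}_{\mathbf d}(y_{\mathbf d-1})$ are the problem defining $V^{lm}_{\mathbf d}(y_{\mathbf d-1})$. Algorithm 1 (tolerance $\delta$), starting from given finite cut collections: set $k:=0$, $\underline\vartheta^m_1:=-\infty$, $\overline\vartheta^m_1:=+\infty$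 for $m\in\mathcal M$. Each iteration: $k:=k+1$. Forward pass: choose $m_1\in\arg\max\{\overline\vartheta^m_1-\underline\vartheta^m_1:\pi^m_1>0\}$; solve $\mathrm{LP}^{m_1}_1$, obtaining an optimal $\underline y_1$ and values $\underline\vartheta^{\omega n}_2$; solve $\mathrm{UP}^{m_1}_1(\underline y_1)$ (first-stage decision fixed to $\underline y_1$), obtaining optimal values $\overline{\underline\vartheta}^{\omega n}_2$. Set $d:=1$, $\hat d:=\mathbf d$ and repeat: $d:=d+1$; choose $(\omega_{d-1},m_d)\in\arg\max\{\overline{\underline\vartheta}^{\omega n}_d-\underline\vartheta^{\omega n}_d:\omega\in\Omega,n\in\mathcal M,\pi^{m_{d-1}n}_d>0\}$; if this maximum exceeds $\delta(\mathbf d-d+1)/(\mathbf d-1)$, solve $\mathrm{LP}^{m_{d-1}m_d}_d(\underline y^{\omega_{d-1}}_{d-1})$ obtaining an optimal $\underline y_d$ and values $\underline\vartheta^{\omega n}_{d+1}$, and solve $\mathrm{UP}^{m_{d-1}m_d}_d(\underline y^{\omega_{d-1}}_{d-1},\underline y_d)$ obtaining $\overline{\underline\vartheta}^{\omega n}_{d+1}$; otherwise set $\hat d:=d-1$; stop repeating when $\hat d=d-1$ or $d=\mathbf d$. Backward pass: for $d=\hat d,\hat d-1,\dots,2$: solve $\mathrm{LP}^{m_{d-1}m_d}_d(\underline y^{\omega_{d-1}}_{d-1})$, obtaining its optimal value $\underline\theta$ and a subgradient $\underline\sigma$ of its optimal value with respect to the argument at $\underline y^{\omega_{d-1}}_{d-1}$;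 solve $\mathrm{UP}^{m_{d-1}m_d}_d(\underline y^{\omega_{d-1}}_{d-1})$, obtaining its optimal value $\overline\theta$; add $(\underline\theta,\underline\sigma,\underline y^{\omega_{d-1}}_{d-1})$ to the collection for next state $m_d$ of $\mathrm{LP}^{m_{d-2}m_{d-1}}_{d-1}$ and $(\overline\theta,\underline y^{\omega_{d-1}}_{d-1})$ to the collection for $m_d$ of $\mathrm{UP}^{m_{d-2}m_{d-1}}_{d-1}$ (for $d=2$ these are $\mathrm{LP}^{m_1}_1$, $\mathrm{UP}^{m_1}_1$). Then solve $\mathrm{LP}^{m_1}_1$ and $\mathrm{UP}^{m_1}_1$ and set $\underline\vartheta^{m_1}_1,\overline\vartheta^{m_1}_1$ to their optimal values; set $\underline\theta^k:=\sum_m\pi^m_1\underline\vartheta^m_1$, $\overline\theta^k:=\sum_m\pi^m_1\overline\vartheta^m_1$; stop if $\overline\theta^k-\underline\theta^k\le\delta$. *)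

theory Defs
  imports "HOL-Analysis.Analysis"
begin

text \<open>A vector of R^k is represented as a function v :: nat => real with v i = 0 for i >= k.
  Matrices are functions nat => nat => real (row, column).\<close>

definition vsp :: "nat \<Rightarrow> (nat \<Rightarrow> real) set" where
  "vsp k = {v. \<forall>i\<ge>k. v i = 0}"

definition ip :: "nat \<Rightarrow> (nat \<Rightarrow> real) \<Rightarrow> (nat \<Rightarrow> real) \<Rightarrow> real" where
  "ip k u v = (\<Sum>i<k. u i * v i)"

definition norm1 :: "nat \<Rightarrow> (nat \<Rightarrow> real) \<Rightarrow> real" where
  "norm1 k v = (\<Sum>i<k. \<bar>v i\<bar>)"

definition vconvex :: "(nat \<Rightarrow> real) set \<Rightarrow> bool" where
  "vconvex S \<longleftrightarrow> (\<forall>u\<in>S. \<forall>v\<in>S. \<forall>t::real. 0 \<le> t \<and> t \<le> 1 \<longrightarrow>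
      (\<lambda>i. t * u i + (1 - t) * v i) \<in> S)"

text \<open>States 's (the finite set M), scenarios 'w (the finite set Omega).
  Stage d decisions (single scenario) live in R^(dimy d); the constraint matrix A_d has
  dimr d rows.  Bmap d x b is the bilinear right-hand side x^T B_d b.\<close>

record ('s, 'w, 'x, 'b) msdata =
  nst  :: nat                                   \<comment> \<open>number of stages, bold d\<close>
  dimy :: "nat \<Rightarrow> nat"
  dimr :: "nat \<Rightarrow> nat"
  p1   :: "'s \<Rightarrow> real"
  ptr  :: "nat \<Rightarrow> 's \<Rightarrow> 's \<Rightarrow> real"
  cost :: "nat \<Rightarrow> nat \<Rightarrow> real"
  Am   :: "nat \<Rightarrow> nat \<Rightarrow> nat \<Rightarrow> real"
  Cm   :: "nat \<Rightarrow> nat \<Rightarrow> nat \<Rightarrow> real"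
  Bmap :: "nat \<Rightarrow> 'x \<Rightarrow> 'b \<Rightarrow> nat \<Rightarrow> real"
  b1   :: "'s \<Rightarrow> 'w \<Rightarrow> 'b"
  bd   :: "nat \<Rightarrow> 's \<Rightarrow> 's \<Rightarrow> 'w \<Rightarrow> 'b"
  Yset :: "nat \<Rightarrow> ('w \<Rightarrow> nat \<Rightarrow> real) set"

definition pw :: "'w::finite itself \<Rightarrow> real" where
  "pw _ = 1 / real CARD('w)"

definition Ycomp :: "('s,'w,'x,'b) msdata \<Rightarrow> nat \<Rightarrow> 'w \<Rightarrow> (nat \<Rightarrow> real) set" where
  "Ycomp Q d \<omega> = (\<lambda>y. y \<omega>) ` Yset Q d"

text \<open>admissible arguments of the stage-d problems (d >= 2): stage d-1 single-scenario decisions\<close>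
definition adm :: "('s,'w,'x,'b) msdata \<Rightarrow> nat \<Rightarrow> (nat \<Rightarrow> real) set" where
  "adm Q d = (\<Union>\<omega>. Ycomp Q (d - 1) \<omega>)"

definition rhsv :: "('s,'w,'x,'b) msdata \<Rightarrow> 'x \<Rightarrow> nat \<Rightarrow> 's \<Rightarrow> 's \<Rightarrow> 'w \<Rightarrow> (nat \<Rightarrow> real) \<Rightarrow> nat \<Rightarrow> real" where
  "rhsv Q x d l m \<omega> yp = (if d = 1 then Bmap Q 1 x (b1 Q m \<omega>)
     else (\<lambda>i. Bmap Q d x (bd Q d l m \<omega>) i + (\<Sum>j<dimy Q (d - 1). Cm Q d i j * yp j)))"

definition feas :: "('s,'w,'x,'b) msdata \<Rightarrow> 'x \<Rightarrow> nat \<Rightarrow> 's \<Rightarrow> 's \<Rightarrow> (nat \<Rightarrow> real) \<Rightarrow> ('w \<Rightarrow> nat \<Rightarrow> real) set" where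
  "feas Q x d l m yp = {y \<in> Yset Q d. \<forall>\<omega> i. i < dimr Q d \<longrightarrow>
      (\<Sum>j<dimy Q d. Am Q d i j * y \<omega> j) \<le> rhsv Q x d l m \<omega> yp i}"

definition scost :: "('s,'w,'x,'b) msdata \<Rightarrow> nat \<Rightarrow> (nat \<Rightarrow> real) \<Rightarrow> real" where
  "scost Q d v = ip (dimy Q d) (cost Q d) v"

section \<open>True value functions V^{lm}_d (extended-real valued, +infinity if infeasible)\<close>

text \<open>Vk Q x k d l m yp is the value of the stage-d problem when k = bold d - d.\<close>
fun Vk :: "('s::finite,'w::finite,'x,'b) msdata \<Rightarrow> 'x \<Rightarrow> nat \<Rightarrow> nat \<Rightarrow> 's \<Rightarrow> 's \<Rightarrow> (nat \<Rightarrow> real) \<Rightarrow> ereal" where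
  "Vk Q x 0 d l m yp =
     (INF y\<in>feas Q x d l m yp. ereal (\<Sum>\<omega>::'w\<in>UNIV. pw TYPE('w) * scost Q d (y \<omega>)))"
| "Vk Q x (Suc k) d l m yp =
     (INF y\<in>feas Q x d l m yp. (\<Sum>\<omega>::'w\<in>UNIV. ereal (pw TYPE('w)) *
        (ereal (scost Q d (y \<omega>)) + (\<Sum>n\<in>UNIV. ereal (ptr Q (d + 1) m n) * Vk Q x k (d + 1) m n (y \<omega>)))))"

definition V :: "('s::finite,'w::finite,'x,'b) msdata \<Rightarrow> 'x \<Rightarrow> nat \<Rightarrow> 's \<Rightarrow> 's \<Rightarrow> (nat \<Rightarrow> real) \<Rightarrow> ereal" where
  "V Q x d l m yp = Vk Q x (nst Q - d) d l m yp"

definition is_subgrad :: "nat \<Rightarrow> ((nat \<Rightarrow> real) \<Rightarrow> ereal) \<Rightarrow> (nat \<Rightarrow> real) \<Rightarrow> (nat \<Rightarrow> real) \<Rightarrow> bool" where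
  "is_subgrad k f y \<sigma> \<longleftrightarrow> y \<in> vsp k \<and> \<sigma> \<in> vsp k \<and> \<bar>f y\<bar> \<noteq> \<infinity> \<and>
     (\<forall>z\<in>vsp k. f y + ereal (ip k \<sigma> (\<lambda>i. z i - y i)) \<le> f z)"

definition data_ok :: "('s::finite,'w::finite,'x,'b) msdata \<Rightarrow> bool" where
  "data_ok Q \<longleftrightarrow> nst Q \<ge> 2
    \<and> (\<forall>m. p1 Q m \<ge> 0) \<and> (\<Sum>m\<in>UNIV. p1 Q m) = 1
    \<and> (\<forall>d\<in>{2..nst Q}. \<forall>l. (\<forall>m. ptr Q d l m \<ge> 0) \<and> (\<Sum>m\<in>UNIV. ptr Q d l m) = 1)
    \<and> (\<forall>d\<in>{1..nst Q}.
         (\<forall>y\<in>Yset Q d. \<forall>\<omega>. y \<omega> \<in> vsp (dimy Q d))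
         \<comment> \<open>Y_d is described by finitely many linear constraints (possibly linking scenarios)\<close>
       \<and> (\<exists>F::(('w \<Rightarrow> nat \<Rightarrow> real) \<times> real) set. finite F \<and>
            Yset Q d = {y. (\<forall>\<omega>. y \<omega> \<in> vsp (dimy Q d)) \<and>
               (\<forall>(a, \<beta>)\<in>F. (\<Sum>\<omega>\<in>UNIV. ip (dimy Q d) (a \<omega>) (y \<omega>)) \<le> \<beta>)})
       \<and> (\<forall>\<omega>. vconvex (Ycomp Q d \<omega>) \<and> compact (Ycomp Q d \<omega>)))"

definition rel_complete_recourse :: "('s::finite,'w::finite,'x,'b) msdata \<Rightarrow> 'x \<Rightarrow> bool" where
  "rel_complete_recourse Q x \<longleftrightarrow>
     (\<forall>l m yp. feas Q x 1 l m yp \<noteq> {} \<and> \<bar>V Q x 1 l m yp\<bar> \<noteq> \<infinity>)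
   \<and> (\<forall>d\<in>{2..nst Q}. \<forall>l m. \<forall>yp\<in>adm Q d. feas Q x d l m yp \<noteq> {} \<and> \<bar>V Q x d l m yp\<bar> \<noteq> \<infinity>)"

definition bounded_subgradients :: "('s::finite,'w::finite,'x,'b) msdata \<Rightarrow> 'x \<Rightarrow> real \<Rightarrow> bool" where
  "bounded_subgradients Q x My \<longleftrightarrow> My > 0 \<and>
     (\<forall>d\<in>{2..nst Q}. \<forall>l m. \<forall>y\<in>adm Q d. \<forall>\<sigma>.
        is_subgrad (dimy Q (d - 1)) (V Q x d l m) y \<sigma> \<longrightarrow> norm1 (dimy Q (d - 1)) \<sigma> \<le> My)"

text \<open>Problem identifier of LP^{lm}_d / UP^{lm}_d (for d = 1 there is no index l).\<close>
type_synonym 's pkey = "nat \<times> 's option \<times> 's"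

definition ckey :: "nat \<Rightarrow> 's \<Rightarrow> 's \<Rightarrow> 's pkey" where
  "ckey d l m = (d, (if d = 1 then None else Some l), m)"

text \<open>lower cuts (theta, sigma, y_s) and upper points (theta, y_s), per problem and next state n\<close>
type_synonym 's lcuts = "'s pkey \<Rightarrow> 's \<Rightarrow> (real \<times> (nat \<Rightarrow> real) \<times> (nat \<Rightarrow> real)) set"
type_synonym 's ucuts = "'s pkey \<Rightarrow> 's \<Rightarrow> (real \<times> (nat \<Rightarrow> real)) set"

definition aobj :: "('s::finite,'w::finite,'x,'b) msdata \<Rightarrow> nat \<Rightarrow> 's \<Rightarrow> ('w \<Rightarrow> nat \<Rightarrow> real) \<Rightarrow> ('w \<Rightarrow> 's \<Rightarrow> real) \<Rightarrow> real" where
  "aobj Q d m y th = (\<Sum>\<omega>::'w\<in>UNIV. pw TYPE('w) * (scost Q d (y \<omega>) +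
       (if d < nst Q then (\<Sum>n\<in>UNIV. ptr Q (d + 1) m n * th \<omega> n) else 0)))"

definition LPfeas :: "('s::finite,'w::finite,'x,'b) msdata \<Rightarrow> 'x \<Rightarrow> 's lcuts \<Rightarrow> nat \<Rightarrow> 's \<Rightarrow> 's \<Rightarrow> (nat \<Rightarrow> real)
     \<Rightarrow> (('w \<Rightarrow> nat \<Rightarrow> real) \<times> ('w \<Rightarrow> 's \<Rightarrow> real)) set" where
  "LPfeas Q x LC d l m yp = {(y, th). y \<in> feas Q x d l m yp \<and>
     (d < nst Q \<longrightarrow> (\<forall>\<omega> n. \<forall>(\<theta>, \<sigma>, ys)\<in>LC (ckey d l m) n.
         \<theta> + ip (dimy Q d) \<sigma> (\<lambda>i. y \<omega> i - ys i) \<le> th \<omega> n))}"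

definition LPval :: "('s::finite,'w::finite,'x,'b) msdata \<Rightarrow> 'x \<Rightarrow> 's lcuts \<Rightarrow> nat \<Rightarrow> 's \<Rightarrow> 's \<Rightarrow> (nat \<Rightarrow> real) \<Rightarrow> ereal" where
  "LPval Q x LC d l m yp = (INF (y, th)\<in>LPfeas Q x LC d l m yp. ereal (aobj Q d m y th))"

definition LPopt :: "('s::finite,'w::finite,'x,'b) msdata \<Rightarrow> 'x \<Rightarrow> 's lcuts \<Rightarrow> nat \<Rightarrow> 's \<Rightarrow> 's \<Rightarrow> (nat \<Rightarrow> real)
     \<Rightarrow> ('w \<Rightarrow> nat \<Rightarrow> real) \<Rightarrow> ('w \<Rightarrow> 's \<Rightarrow> real) \<Rightarrow> bool" where
  "LPopt Q x LC d l m yp y th \<longleftrightarrow> (y, th) \<in> LPfeas Q x LC d l m yp \<and>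
     (\<forall>(y', th')\<in>LPfeas Q x LC d l m yp. aobj Q d m y th \<le> aobj Q d m y' th')"

text \<open>variables of UP: y, theta-bar, gamma, mu (mu indexed by the elements of the collection)\<close>
definition UPfeas :: "('s::finite,'w::finite,'x,'b) msdata \<Rightarrow> 'x \<Rightarrow> real \<Rightarrow> 's ucuts \<Rightarrow> nat \<Rightarrow> 's \<Rightarrow> 's \<Rightarrow> (nat \<Rightarrow> real)
     \<Rightarrow> (('w \<Rightarrow> nat \<Rightarrow> real) \<times> ('w \<Rightarrow> 's \<Rightarrow> real) \<times> ('w \<Rightarrow> 's \<Rightarrow> nat \<Rightarrow> real)
          \<times> ('w \<Rightarrow> 's \<Rightarrow> real \<times> (nat \<Rightarrow> real) \<Rightarrow> real)) set" where
  "UPfeas Q x My UC d l m yp = {(y, th, \<gamma>, \<mu>). y \<in> feas Q x d l m yp \<and>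
     (d < nst Q \<longrightarrow> (\<forall>\<omega> n.
         (\<forall>s\<in>UC (ckey d l m) n. 0 \<le> \<mu> \<omega> n s)
       \<and> (\<Sum>s\<in>UC (ckey d l m) n. \<mu> \<omega> n s) = 1
       \<and> \<gamma> \<omega> n \<in> vsp (dimy Q d)
       \<and> (\<forall>i<dimy Q d. (\<Sum>s\<in>UC (ckey d l m) n. \<mu> \<omega> n s * snd s i) = y \<omega> i + \<gamma> \<omega> n i)
       \<and> (\<Sum>s\<in>UC (ckey d l m) n. \<mu> \<omega> n s * fst s) + My * norm1 (dimy Q d) (\<gamma> \<omega> n) \<le> th \<omega> n))}"

definition UPval :: "('s::finite,'w::finite,'x,'b) msdata \<Rightarrow> 'x \<Rightarrow> real \<Rightarrow> 's ucuts \<Rightarrow> nat \<Rightarrow> 's \<Rightarrow> 's \<Rightarrow> (nat \<Rightarrow> real) \<Rightarrow> ereal" where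
  "UPval Q x My UC d l m yp = (INF (y, th, \<gamma>, \<mu>)\<in>UPfeas Q x My UC d l m yp. ereal (aobj Q d m y th))"

definition UPopt_fixed :: "('s::finite,'w::finite,'x,'b) msdata \<Rightarrow> 'x \<Rightarrow> real \<Rightarrow> 's ucuts \<Rightarrow> nat \<Rightarrow> 's \<Rightarrow> 's \<Rightarrow> (nat \<Rightarrow> real)
     \<Rightarrow> ('w \<Rightarrow> nat \<Rightarrow> real) \<Rightarrow> ('w \<Rightarrow> 's \<Rightarrow> real) \<Rightarrow> ('w \<Rightarrow> 's \<Rightarrow> nat \<Rightarrow> real)
     \<Rightarrow> ('w \<Rightarrow> 's \<Rightarrow> real \<times> (nat \<Rightarrow> real) \<Rightarrow> real) \<Rightarrow> bool" where
  "UPopt_fixed Q x My UC d l m yp ytil th \<gamma> \<mu> \<longleftrightarrow>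
     (ytil, th, \<gamma>, \<mu>) \<in> UPfeas Q x My UC d l m yp \<and>
     (\<forall>(y', th', \<gamma>', \<mu>')\<in>UPfeas Q x My UC d l m yp. y' = ytil \<longrightarrow> aobj Q d m ytil th \<le> aobj Q d m y' th')"

text \<open>state between iterations: cut collections and the bounds underline/overline vartheta^m_1\<close>
type_synonym 's astate = "'s lcuts \<times> 's ucuts \<times> ('s \<Rightarrow> ereal) \<times> ('s \<Rightarrow> ereal)"

definition lower_bound :: "('s::finite,'w,'x,'b) msdata \<Rightarrow> 's astate \<Rightarrow> ereal" where
  "lower_bound Q st = (case st of (LC, UC, lo, up) \<Rightarrow> (\<Sum>m\<in>UNIV. ereal (p1 Q m) * lo m))"

definition upper_bound :: "('s::finite,'w,'x,'b) msdata \<Rightarrow> 's astate \<Rightarrow> ereal" where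
  "upper_bound Q st = (case st of (LC, UC, lo, up) \<Rightarrow> (\<Sum>m\<in>UNIV. ereal (p1 Q m) * up m))"

definition initial_state :: "'s lcuts \<Rightarrow> 's ucuts \<Rightarrow> 's astate" where
  "initial_state LC0 UC0 = (LC0, UC0, (\<lambda>_. - \<infinity>), (\<lambda>_. \<infinity>))"

definition thr :: "('s,'w,'x,'b) msdata \<Rightarrow> real \<Rightarrow> nat \<Rightarrow> real" where
  "thr Q \<delta> d = \<delta> * real (nst Q - d + 1) / real (nst Q - 1)"

text \<open>One iteration of Algorithm 1 transforming state st into st'.  The nondeterministic
  choices (argmax selections, optimal solutions, subgradients) are existentially quantified:
  m, om are the chosen states m_d and scenarios omega_d, y d the forward solutions underline y_d,
  thl (d+1) the values underline vartheta_{d+1}, thu (d+1) the values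
  overline-underline vartheta_{d+1}, dh the value of hat d after the forward pass, and
  LCs d / UCs d the collections after the backward pass has treated stages dh, ..., d
  (LCs (dh+1) = current collections).\<close>
definition alg_iter :: "('s::finite,'w::finite,'x,'b) msdata \<Rightarrow> 'x \<Rightarrow> real \<Rightarrow> real \<Rightarrow> 's astate \<Rightarrow> 's astate \<Rightarrow> bool" where
  "alg_iter Q x My \<delta> st st' \<longleftrightarrow> (case st of (LC, UC, lo, up) \<Rightarrow>
   (\<exists>(m::nat \<Rightarrow> 's) (om::nat \<Rightarrow> 'w) (y::nat \<Rightarrow> 'w \<Rightarrow> nat \<Rightarrow> real)
      (thl::nat \<Rightarrow> 'w \<Rightarrow> 's \<Rightarrow> real) (thu::nat \<Rightarrow> 'w \<Rightarrow> 's \<Rightarrow> real) (dh::nat)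
      (LCs::nat \<Rightarrow> 's lcuts) (UCs::nat \<Rightarrow> 's ucuts).
     \<comment> \<open>forward pass, stage 1\<close>
     p1 Q (m 1) > 0
   \<and> (\<forall>m'. p1 Q m' > 0 \<longrightarrow> up m' - lo m' \<le> up (m 1) - lo (m 1))
   \<and> LPopt Q x LC 1 (m 0) (m 1) (y 0 (om 0)) (y 1) (thl 2)
   \<and> (\<exists>\<gamma> \<mu>. UPopt_fixed Q x My UC 1 (m 0) (m 1) (y 0 (om 0)) (y 1) (thu 2) \<gamma> \<mu>)
     \<comment> \<open>forward pass, stages 2..hat d (steps where the maximal gap exceeded the threshold)\<close>
   \<and> 1 \<le> dh \<and> dh \<le> nst Q
   \<and> (\<forall>d\<in>{2..dh}.
        ptr Q d (m (d - 1)) (m d) > 0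
      \<and> (\<forall>\<omega> n. ptr Q d (m (d - 1)) n > 0 \<longrightarrow>
            thu d \<omega> n - thl d \<omega> n \<le> thu d (om (d - 1)) (m d) - thl d (om (d - 1)) (m d))
      \<and> thu d (om (d - 1)) (m d) - thl d (om (d - 1)) (m d) > thr Q \<delta> d
      \<and> LPopt Q x LC d (m (d - 1)) (m d) (y (d - 1) (om (d - 1))) (y d) (thl (d + 1))
      \<and> (d < nst Q \<longrightarrow> (\<exists>\<gamma> \<mu>. UPopt_fixed Q x My UC d (m (d - 1)) (m d) (y (d - 1) (om (d - 1)))
                              (y d) (thu (d + 1)) \<gamma> \<mu>)))
     \<comment> \<open>the forward pass stopped early at d = hat d + 1: maximal gap below threshold\<close>
   \<and> (dh < nst Q \<longrightarrow> (\<forall>\<omega> n. ptr Q (dh + 1) (m dh) n > 0 \<longrightarrow>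
            thu (dh + 1) \<omega> n - thl (dh + 1) \<omega> n \<le> thr Q \<delta> (dh + 1)))
     \<comment> \<open>backward pass, d = hat d, ..., 2\<close>
   \<and> LCs (dh + 1) = LC \<and> UCs (dh + 1) = UC
   \<and> (\<forall>d\<in>{2..dh}. \<exists>\<theta>l \<sigma> \<theta>u.
        LPval Q x (LCs (d + 1)) d (m (d - 1)) (m d) (y (d - 1) (om (d - 1))) = ereal \<theta>l
      \<and> is_subgrad (dimy Q (d - 1)) (LPval Q x (LCs (d + 1)) d (m (d - 1)) (m d))
                   (y (d - 1) (om (d - 1))) \<sigma>
      \<and> UPval Q x My (UCs (d + 1)) d (m (d - 1)) (m d) (y (d - 1) (om (d - 1))) = ereal \<theta>u
      \<and> LCs d = (LCs (d + 1))(ckey (d - 1) (m (d - 2)) (m (d - 1)) :=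
                   (LCs (d + 1) (ckey (d - 1) (m (d - 2)) (m (d - 1))))(m d :=
                      insert (\<theta>l, \<sigma>, y (d - 1) (om (d - 1)))
                        (LCs (d + 1) (ckey (d - 1) (m (d - 2)) (m (d - 1))) (m d))))
      \<and> UCs d = (UCs (d + 1))(ckey (d - 1) (m (d - 2)) (m (d - 1)) :=
                   (UCs (d + 1) (ckey (d - 1) (m (d - 2)) (m (d - 1))))(m d :=
                      insert (\<theta>u, y (d - 1) (om (d - 1)))
                        (UCs (d + 1) (ckey (d - 1) (m (d - 2)) (m (d - 1))) (m d)))))
     \<comment> \<open>resolve LP^{m_1}_1 and UP^{m_1}_1 and update the bounds\<close>
   \<and> st' = (LCs 2, UCs 2,
            lo(m 1 := LPval Q x (LCs 2) 1 (m 0) (m 1) (y 0 (om 0))),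
            up(m 1 := UPval Q x My (UCs 2) 1 (m 0) (m 1) (y 0 (om 0))))))"

end

theory Submission
  imports Defs
begin

text \<open>Consider an iteration whose forward pass stops at a stage \<open>d \<ge> 2\<close>. The new lower cut and
  upper point at the visited argument differ by at most the stage-\<open>d\<close> threshold minus
  \<open>\<delta> / (nst Q - 1)\<close>, whereas the gap seen there in the forward pass exceeded that threshold. Both
  approximations being Lipschitz around the new point, a later iteration stopping at the same stage
  with the same states must visit an argument at a distance bounded away from zero; by compactness
  this happens only finitely often. From then on every forward pass stops at stage 1, which makes
  the first-stage gap of the selected state at most \<open>\<delta>\<close>, and the stopping criterion holds as soon as
  all states of positive probability have been treated.

  The uniform Lipschitz constant of the lower cuts is the delicate point, since only the subgradients
  of the true value functions are assumed to be bounded. These functions have polyhedral epigraphs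
  (Fourier--Motzkin), hence possess subgradients at every admissible argument; boundedness then keeps
  the admissible arguments uniformly inside the domain, which is also the domain of the approximating
  problems. As the values of the latter are uniformly bounded, so are the slopes of the cuts.\<close>

section \<open>Fourier--Motzkin elimination\<close>

text \<open>Affine functions that read only finitely many coordinates, over an index type that may
  be infinite. Generating them one coordinate at a time lets every closure property go by induction
  without handling coefficient vectors.\<close>

inductive_set afun :: "(('i \<Rightarrow> real) \<Rightarrow> real) set" where
  afun_const: "(\<lambda>v. \<beta>) \<in> afun"
| afun_step: "g \<in> afun \<Longrightarrow> (\<lambda>v. g v + c * v i) \<in> afun"

lemma afun_coord: "(\<lambda>v. v i) \<in> afun"
  using afun_step[OF afun_const[of 0], of 1 i] by simp

lemma afun_add:
  assumes "f \<in> afun" "g \<in> afun"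
  shows "(\<lambda>v. f v + g v) \<in> afun"
  using assms(2,1)
proof (induction rule: afun.induct)
  case (afun_const \<beta>)
  then show ?case
  proof (induction rule: afun.induct)
    case (afun_step g c i)
    show ?case using afun.afun_step[OF afun_step.IH, of c i] by (simp add: algebra_simps)
  qed (rule afun.afun_const)
next
  case (afun_step g c i)
  then show ?case using afun.afun_step[OF afun_step.IH, of c i] by (simp add: algebra_simps)
qed

lemma afun_scale: "g \<in> afun \<Longrightarrow> (\<lambda>v. c * g v) \<in> afun"
proof (induction rule: afun.induct)
  case (afun_step g b i)
  show ?case using afun.afun_step[OF afun_step.IH, of "c * b" i] by (simp add: algebra_simps)
qed (rule afun_const)

lemma afun_diff:
  assumes "f \<in> afun" "g \<in> afun"
  shows "(\<lambda>v. f v - g v) \<in> afun"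
  using afun_add[OF assms(1) afun_scale[OF assms(2), of "-1"]] by simp

lemma afun_sum:
  assumes "\<And>k. k \<in> K \<Longrightarrow> g k \<in> afun"
  shows "(\<lambda>v. \<Sum>k\<in>K. g k v) \<in> afun"
  using assms by (induction K rule: infinite_finite_induct) (auto intro: afun_const afun_add)

lemma afun_comp:
  assumes "g \<in> afun" "\<And>i. h i \<in> afun"
  shows "(\<lambda>v. g (\<lambda>i. h i v)) \<in> afun"
  using assms(1)
proof induction
  case (afun_step g c i)
  show ?case by (rule afun_add[OF afun_step.IH afun_scale[OF assms(2)]])
qed (rule afun_const)

lemma afun_fun_upd:
  assumes "g \<in> afun"
  shows "(\<lambda>v. g (v(j := b))) \<in> afun"
proof -
  have "(\<lambda>v. g (\<lambda>i. (if i = j then b else v i))) \<in> afun"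
  proof (rule afun_comp[OF assms])
    show "(\<lambda>v. if i = j then b else v i) \<in> afun" for i
      by (cases "i = j") (simp_all add: afun_const afun_coord)
  qed
  then show ?thesis by (simp add: fun_upd_def)
qed

text \<open>The slope in coordinate \<open>j\<close> does not depend on the other coordinates. Its
  sign tells whether a constraint bounds that coordinate from above, from below, or not at
  all.\<close>

lemma afun_slope:
  assumes "g \<in> afun"
  shows "\<exists>c. \<forall>v s. g (v(j := s)) = g (v(j := 0)) + c * s"
  using assms
proof induction
  case (afun_step g c i)
  then obtain b where b: "\<And>v s. g (v(j := s)) = g (v(j := 0)) + b * s" by blast
  show ?case
  proof (cases "i = j")
    case True
    have "g (v(j := s)) + c * s = g (v(j := 0)) + (b + c) * s" for v s
      using b[of v s] by (simp add: algebra_simps del: fun_upd_apply)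
    then show ?thesis unfolding True fun_upd_same mult_zero_right add_0_right by blast
  next
    case False
    have "g (v(j := s)) + c * v i = g (v(j := 0)) + c * v i + b * s" for v s
      using b[of v s] by linarith
    then show ?thesis unfolding fun_upd_other[OF False] by blast
  qed
qed (auto intro: exI[of _ 0])

section \<open>Polyhedral sets and their projections\<close>

definition polyhedral :: "('i \<Rightarrow> real) set \<Rightarrow> bool" where
  "polyhedral S \<longleftrightarrow> (\<exists>F. finite F \<and> F \<subseteq> afun \<and> S = {v. \<forall>g\<in>F. g v \<le> 0})"

lemma polyhedral_halfspace: "f \<in> afun \<Longrightarrow> g \<in> afun \<Longrightarrow> polyhedral {v. f v \<le> g v}"
  unfolding polyhedral_def
  by (rule exI[of _ "{\<lambda>v. f v - g v}"]) (auto intro: afun_diff)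

lemma polyhedral_INT:
  assumes "finite K" "\<And>k. k \<in> K \<Longrightarrow> polyhedral (S k)"
  shows "polyhedral {v. \<forall>k\<in>K. v \<in> S k}"
proof -
  have "\<forall>k\<in>K. \<exists>F. finite F \<and> F \<subseteq> afun \<and> S k = {v. \<forall>g\<in>F. g v \<le> 0}"
    using assms(2) unfolding polyhedral_def by blast
  then obtain F where F: "\<forall>k\<in>K. finite (F k) \<and> F k \<subseteq> afun \<and> S k = {v. \<forall>g\<in>F k. g v \<le> 0}"
    unfolding bchoice_iff ..
  show ?thesis unfolding polyhedral_def
    by (rule exI[of _ "\<Union>k\<in>K. F k"]) (use F assms(1) in auto)
qed

lemma polyhedral_Int:
  assumes "polyhedral {v. P v}" "polyhedral {v. R v}"
  shows "polyhedral {v. P v \<and> R v}"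
proof -
  have "polyhedral {v. \<forall>S\<in>{{v. P v}, {v. R v}}. v \<in> S}"
    by (rule polyhedral_INT) (use assms in auto)
  then show ?thesis by simp
qed

lemma polyhedral_comp:
  assumes "polyhedral S" "\<And>i. h i \<in> afun"
  shows "polyhedral {v. (\<lambda>i. h i v) \<in> S}"
proof -
  obtain F where F: "finite F" "F \<subseteq> afun" "S = {v. \<forall>g\<in>F. g v \<le> 0}"
    using assms(1) unfolding polyhedral_def by blast
  show ?thesis unfolding polyhedral_def
  proof (intro exI[of _ "(\<lambda>g v. g (\<lambda>i. h i v)) ` F"] conjI)
    show "(\<lambda>g v. g (\<lambda>i. h i v)) ` F \<subseteq> afun"
    proof (rule image_subsetI)
      fix g assume "g \<in> F"
      then show "(\<lambda>v. g (\<lambda>i. h i v)) \<in> afun"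
        by (rule afun_comp[OF subsetD[OF F(2)] assms(2)])
    qed
  qed (use F in auto)
qed

lemma ex_between_finite:
  fixes lo :: "'a \<Rightarrow> real" and hi :: "'b \<Rightarrow> real"
  assumes "finite N" "finite P" "\<And>h g. h \<in> N \<Longrightarrow> g \<in> P \<Longrightarrow> lo h \<le> hi g"
  shows "\<exists>s. (\<forall>h\<in>N. lo h \<le> s) \<and> (\<forall>g\<in>P. s \<le> hi g)"
proof (cases "N = {}")
  case True
  show ?thesis
  proof (cases "P = {}")
    case False
    then show ?thesis using True assms(2) by (intro exI[of _ "Min (hi ` P)"]) auto
  qed (use True in auto)
next
  case False
  then show ?thesis using assms by (intro exI[of _ "Max (lo ` N)"]) auto
qed

text \<open>One Fourier--Motzkin step. Constraints of positive slope bound \<open>s\<close> from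
  above, those of negative slope from below; a suitable \<open>s\<close> exists iff every lower
  bound is at most every upper bound, which is again a finite affine system in the remaining
  coordinates.\<close>

lemma polyhedral_eliminate:
  assumes "polyhedral S"
  shows "polyhedral {v. \<exists>s. v(j := s) \<in> S}"
proof -
  obtain F where F: "finite F" "F \<subseteq> afun" "S = {v. \<forall>g\<in>F. g v \<le> 0}"
    using assms unfolding polyhedral_def by blast
  have "\<forall>g\<in>F. \<exists>c. \<forall>v s. g (v(j := s)) = g (v(j := 0)) + c * s"
  proof
    fix g assume "g \<in> F"
    then show "\<exists>c. \<forall>v s. g (v(j := s)) = g (v(j := 0)) + c * s"
      by (rule afun_slope[OF subsetD[OF F(2)]])
  qed
  then obtain c where "\<forall>g\<in>F. \<forall>v s. g (v(j := s)) = g (v(j := 0)) + c g * s"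
    unfolding bchoice_iff ..
  then have c: "\<And>g v s. g \<in> F \<Longrightarrow> g (v(j := s)) = g (v(j := 0)) + c g * s" by blast
  define P N Z where "P = {g\<in>F. c g > 0}" and "N = {g\<in>F. c g < 0}" and "Z = {g\<in>F. c g = 0}"
  \<comment> \<open>For \<open>g\<close> in \<open>P\<close> and \<open>h\<close> in
    \<open>N\<close> the multipliers \<open>c g\<close> and \<open>- c h\<close> are positive and
    make the terms in \<open>s\<close> cancel.\<close>
  define cmb where "cmb = (\<lambda>(g, h) v. c g * h (v(j := 0)) - c h * g (v(j := (0::real))))"
  let ?G = "(\<lambda>g v. g (v(j := 0))) ` Z \<union> cmb ` (P \<times> N)"
  have fin: "finite P" "finite N" "finite Z" using F(1) by (auto simp: P_def N_def Z_def)
  have "(\<exists>s. v(j := s) \<in> S) \<longleftrightarrow> (\<forall>g\<in>?G. g v \<le> 0)" for v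
  proof
    assume "\<exists>s. v(j := s) \<in> S"
    then obtain s where "\<And>g. g \<in> F \<Longrightarrow> g (v(j := s)) \<le> 0" unfolding F(3) by blast
    then have s: "g (v(j := 0)) + c g * s \<le> 0" if "g \<in> F" for g
      using c[OF that, of v s] that by (metis)
    have "cmb (g, h) v \<le> 0" if "g \<in> P" "h \<in> N" for g h
    proof -
      have gh: "c g > 0" "c h < 0" "g \<in> F" "h \<in> F" using that by (auto simp: P_def N_def)
      have "c g * (h (v(j := 0)) + c h * s) \<le> 0" "c h * (g (v(j := 0)) + c g * s) \<ge> 0"
        using gh s by (auto intro: mult_nonneg_nonpos mult_nonpos_nonpos)
      then show ?thesis by (simp add: cmb_def algebra_simps)
    qed
    moreover have "g (v(j := 0)) \<le> 0" if "g \<in> Z" for g using s[of g] that by (simp add: Z_def)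
    ultimately show "\<forall>g\<in>?G. g v \<le> 0" by blast
  next
    assume G: "\<forall>g\<in>?G. g v \<le> 0"
    have "\<exists>s. (\<forall>h\<in>N. - h (v(j := 0)) / c h \<le> s) \<and> (\<forall>g\<in>P. s \<le> - g (v(j := 0)) / c g)"
    proof (rule ex_between_finite[OF fin(2,1)])
      fix h g assume "h \<in> N" "g \<in> P"
      then have "cmb (g, h) v \<le> 0" "c g > 0" "c h < 0" using G by (auto simp: P_def N_def)
      then show "- h (v(j := 0)) / c h \<le> - g (v(j := 0)) / c g"
        by (simp add: cmb_def field_simps)
    qed
    then obtain s where s: "\<And>h. h \<in> N \<Longrightarrow> - h (v(j := 0)) / c h \<le> s"
      "\<And>g. g \<in> P \<Longrightarrow> s \<le> - g (v(j := 0)) / c g" by blast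
    have "g (v(j := s)) \<le> 0" if "g \<in> F" for g
    proof -
      consider "g \<in> P" | "g \<in> N" | "g \<in> Z" using \<open>g \<in> F\<close> by (force simp: P_def N_def Z_def)
      then have "g (v(j := 0)) + c g * s \<le> 0"
      proof cases
        case 1 then show ?thesis using s(2)[OF 1] by (simp add: P_def field_simps)
      next
        case 2 then show ?thesis using s(1)[OF 2] by (simp add: N_def field_simps)
      next
        case 3 then show ?thesis using G by (auto simp: Z_def)
      qed
      then show ?thesis using c[OF that, of v s] by linarith
    qed
    then show "\<exists>s. v(j := s) \<in> S" using F(3) by blast
  qed
  moreover have "?G \<subseteq> afun"
  proof -
    have *: "(\<lambda>v. g (v(j := 0))) \<in> afun" if "g \<in> F" for g
      by (rule afun_fun_upd) (use that F(2) in auto)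
    have "cmb (g, h) \<in> afun" if "g \<in> F" "h \<in> F" for g h
      unfolding cmb_def prod.case by (intro afun_diff afun_scale * that)
    then show ?thesis using * by (auto simp: P_def N_def Z_def)
  qed
  ultimately show ?thesis unfolding polyhedral_def
    by (intro exI[of _ ?G]) (use fin in auto)
qed

lemma polyhedral_project:
  assumes "finite J" "polyhedral S"
  shows "polyhedral {v. \<exists>w\<in>S. \<forall>i. i \<notin> J \<longrightarrow> w i = v i}"
  using assms(1)
proof induction
  case empty
  have "{v. \<exists>w\<in>S. \<forall>i. i \<notin> {} \<longrightarrow> w i = v i} = S" by (auto simp: fun_eq_iff[symmetric])
  then show ?case using assms(2) by simp
next
  case (insert j J)
  have "{v. \<exists>w\<in>S. \<forall>i. i \<notin> insert j J \<longrightarrow> w i = v i}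
     = {v. \<exists>s. v(j := s) \<in> {v. \<exists>w\<in>S. \<forall>i. i \<notin> J \<longrightarrow> w i = v i}}"
    (is "?L = ?R")
  proof
    show "?L \<subseteq> ?R"
    proof
      fix v assume "v \<in> ?L"
      then obtain w where "w \<in> S" "\<forall>i. i \<notin> insert j J \<longrightarrow> w i = v i" by blast
      then have "\<forall>i. i \<notin> J \<longrightarrow> w i = (v(j := w j)) i" by simp
      then show "v \<in> ?R" using \<open>w \<in> S\<close> by blast
    qed
    show "?R \<subseteq> ?L"
    proof
      fix v assume "v \<in> ?R"
      then obtain s w where "w \<in> S" "\<forall>i. i \<notin> J \<longrightarrow> w i = (v(j := s)) i" by blast
      then have "\<forall>i. i \<notin> insert j J \<longrightarrow> w i = v i" by simp
      then show "v \<in> ?L" using \<open>w \<in> S\<close> by blast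
    qed
  qed
  then show ?case using polyhedral_eliminate[OF insert.IH] by simp
qed

section \<open>Polyhedral functions with bounded subgradients\<close>

lemma afun_ip:
  assumes "\<And>j. (\<lambda>v. h v j) \<in> afun"
  shows "(\<lambda>v. ip k a (h v)) \<in> afun"
  unfolding ip_def by (intro afun_sum afun_scale assms)

text \<open>Coordinate \<open>None\<close> is the height, \<open>Some i\<close> the argument.
  Attainment of an infimum is not known beforehand, so a projected set is first seen to contain only
  the points strictly above the graph. Its constraints are affine in the height, so letting the
  excess height tend to 0 yields the points on the graph as well.\<close>

lemma epigraph_eqI:
  fixes f :: "(nat \<Rightarrow> real) \<Rightarrow> ereal"
  assumes "polyhedral E"
    and sound: "\<And>u. u \<in> E \<Longrightarrow> f (\<lambda>i. u (Some i)) \<le> ereal (u None)"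
    and approx: "\<And>u. f (\<lambda>i. u (Some i)) < ereal (u None) \<Longrightarrow> u \<in> E"
  shows "E = {u. f (\<lambda>i. u (Some i)) \<le> ereal (u None)}"
proof
  show "{u. f (\<lambda>i. u (Some i)) \<le> ereal (u None)} \<subseteq> E"
  proof clarify
    fix u :: "nat option \<Rightarrow> real" assume u: "f (\<lambda>i. u (Some i)) \<le> ereal (u None)"
    obtain F where F: "F \<subseteq> afun" "E = {v. \<forall>g\<in>F. g v \<le> 0}"
      using assms(1) unfolding polyhedral_def by blast
    have "g u \<le> 0" if "g \<in> F" for g
    proof -
      obtain c where c: "\<And>v s. g (v(None := s)) = g (v(None := 0)) + c * s"
        using afun_slope[OF subsetD[OF F(1) \<open>g \<in> F\<close>], of None] by blast
      have gu: "g u = g (u(None := 0)) + c * u None" using c[of u "u None"] by simp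
      have step: "g u + c * s \<le> 0" if "s > 0" for s
      proof -
        have "f (\<lambda>i. (u(None := u None + s)) (Some i)) < ereal ((u(None := u None + s)) None)"
          using u that by (simp add: le_less_trans)
        then have "g (u(None := u None + s)) \<le> 0" using approx \<open>g \<in> F\<close> F(2) by blast
        then show ?thesis using c[of u "u None + s"] gu by (simp add: algebra_simps)
      qed
      show ?thesis
      proof (rule field_le_epsilon)
        fix e :: real assume "e > 0"
        \<comment> \<open>The excess height is scaled so that it changes \<open>g\<close> by at most
          \<open>e\<close>, whatever the size of \<open>c\<close>.\<close>
        have "g u + c * (e / (\<bar>c\<bar> + 1)) \<le> 0" using \<open>e > 0\<close> by (intro step) auto
        moreover have "- c * (e / (\<bar>c\<bar> + 1)) \<le> e"
        proof -
          have "- c * e \<le> e * (\<bar>c\<bar> + 1)" using \<open>e > 0\<close> mult_right_mono[OF abs_ge_minus_self[of c], of e]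
            by (simp add: algebra_simps)
          then show ?thesis by (simp add: field_simps)
        qed
        ultimately show "g u \<le> 0 + e" by simp
      qed
    qed
    then show "u \<in> E" using F(2) by blast
  qed
qed (use sound in blast)

section \<open>Inner product and 1-norm\<close>

lemma ip_diff_right: "ip k a (\<lambda>i. u i - v i) = ip k a u - ip k a v"
  by (simp add: ip_def right_diff_distrib sum_subtractf)

lemma ip_add_left: "ip k (\<lambda>i. a i + s * b i) u = ip k a u + s * ip k b u"
  by (simp add: ip_def distrib_right sum.distrib sum_distrib_left mult.assoc)

lemma ip_scale_left: "ip k (\<lambda>i. s * b i) u = s * ip k b u"
  by (simp add: ip_def sum_distrib_left mult.assoc)

lemma ip_fun_upd: "i < k \<Longrightarrow> ip k a (z(i := z i + s)) = ip k a z + a i * s"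
proof -
  assume "i < k"
  have "ip k a (z(i := z i + s)) = (\<Sum>j<k. a j * z j + (if j = i then a i * s else 0))"
    unfolding ip_def by (intro sum.cong refl) (auto simp: algebra_simps)
  then show ?thesis using \<open>i < k\<close> by (simp add: sum.distrib ip_def)
qed

lemma abs_ip_le:
  assumes "\<And>i. i < k \<Longrightarrow> \<bar>u i\<bar> \<le> C"
  shows "\<bar>ip k u v\<bar> \<le> C * norm1 k v"
proof -
  have "\<bar>ip k u v\<bar> \<le> (\<Sum>i<k. \<bar>u i * v i\<bar>)" unfolding ip_def by (rule sum_abs)
  also have "\<dots> \<le> (\<Sum>i<k. C * \<bar>v i\<bar>)"
    by (intro sum_mono) (auto simp: abs_mult intro!: mult_right_mono assms)
  finally show ?thesis by (simp add: norm1_def sum_distrib_left)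
qed

lemma ip_commute: "ip k u v = ip k v u"
  by (simp add: ip_def mult.commute)

lemma norm1_component: "i < k \<Longrightarrow> \<bar>v i\<bar> \<le> norm1 k v"
  unfolding norm1_def by (intro member_le_sum) auto

lemma norm1_nonneg: "norm1 k v \<ge> 0"
  by (simp add: norm1_def sum_nonneg)

lemma norm1_minus_commute: "norm1 k (\<lambda>i. u i - v i) = norm1 k (\<lambda>i. v i - u i)"
  by (simp add: norm1_def abs_minus_commute)

lemma continuous_on_ip: "continuous_on S (\<lambda>z. ip k a z)"
  unfolding ip_def
  by (intro continuous_intros continuous_on_subset[OF continuous_on_product_coordinates]) auto

lemma afun_coefficients:
  assumes "g \<in> afun"
  shows "\<exists>\<alpha> \<beta> a. a \<in> vsp k \<and> (\<forall>z\<in>vsp k. \<forall>t. g (case_option t z) = \<beta> + \<alpha> * t + ip k a z)"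
  using assms
proof induction
  case (afun_const \<beta>)
  show ?case by (rule exI[of _ 0], rule exI[of _ \<beta>], rule exI[of _ "\<lambda>_. 0"]) (simp add: vsp_def ip_def)
next
  case (afun_step g c i)
  then obtain \<alpha> \<beta> a where a: "a \<in> vsp k"
    "\<And>z t. z \<in> vsp k \<Longrightarrow> g (case_option t z) = \<beta> + \<alpha> * t + ip k a z" by blast
  show ?case
  proof (cases i)
    case None
    show ?thesis
      by (rule exI[of _ "\<alpha> + c"], rule exI[of _ \<beta>], rule exI[of _ a])
         (use a None in \<open>simp add: algebra_simps\<close>)
  next
    case (Some j)
    show ?thesis
    proof (cases "j < k")
      case True
      have "ip k (a(j := a j + c)) z = ip k a z + c * z j" for z
        using ip_fun_upd[OF True, of z a c] by (simp add: ip_commute mult.commute)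
      moreover have "a(j := a j + c) \<in> vsp k" using a(1) True by (simp add: vsp_def)
      ultimately have "a(j := a j + c) \<in> vsp k \<and> (\<forall>z\<in>vsp k. \<forall>t. g (case_option t z) +
          c * case_option t z i = \<beta> + \<alpha> * t + ip k (a(j := a j + c)) z)"
        using a(2) Some by (simp del: fun_upd_apply)
      then show ?thesis by blast
    next
      case False
      show ?thesis
        by (rule exI[of _ \<alpha>], rule exI[of _ \<beta>], rule exI[of _ a])
           (use a Some False in \<open>auto simp: vsp_def\<close>)
    qed
  qed
qed

text \<open>At a boundary point of the domain, a normal vector of an active constraint could be added
  to any subgradient, making the set of subgradients unbounded.  Polyhedrality is needed to know
  that there is a subgradient at all.\<close>

lemma polyhedral_domain_margin:
  fixes f :: "(nat \<Rightarrow> real) \<Rightarrow> ereal"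
  assumes poly: "polyhedral {u. f (\<lambda>i. u (Some i)) \<le> ereal (u None)}"
    and K: "compact K" "K \<subseteq> vsp k"
    and fin: "\<And>z. z \<in> K \<Longrightarrow> \<bar>f z\<bar> \<noteq> \<infinity>"
    and bnd: "\<And>z \<sigma>. z \<in> K \<Longrightarrow> is_subgrad k f z \<sigma> \<Longrightarrow> norm1 k \<sigma> \<le> M"
  shows "\<exists>r>0. \<forall>z\<in>K. \<forall>i<k. f (z(i := z i + r)) < \<infinity> \<and> f (z(i := z i - r)) < \<infinity>"
proof -
  obtain F where F: "finite F" "F \<subseteq> afun"
    "{u. f (\<lambda>i. u (Some i)) \<le> ereal (u None)} = {v. \<forall>g\<in>F. g v \<le> 0}"
    using poly unfolding polyhedral_def by blast
  have "\<forall>g\<in>F. \<exists>p. snd (snd p) \<in> vsp k \<and>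
     (\<forall>z\<in>vsp k. \<forall>t. g (case_option t z) = fst (snd p) + fst p * t + ip k (snd (snd p)) z)"
  proof
    fix g assume "g \<in> F"
    from afun_coefficients[OF subsetD[OF F(2) this], of k]
    obtain \<alpha> \<beta> a where "a \<in> vsp k" "\<forall>z\<in>vsp k. \<forall>t. g (case_option t z) = \<beta> + \<alpha> * t + ip k a z" by blast
    then show "\<exists>p. snd (snd p) \<in> vsp k \<and>
     (\<forall>z\<in>vsp k. \<forall>t. g (case_option t z) = fst (snd p) + fst p * t + ip k (snd (snd p)) z)"
      by (intro exI[of _ "(\<alpha>, \<beta>, a)"]) simp
  qed
  then obtain p where p: "\<forall>g\<in>F. snd (snd (p g)) \<in> vsp k \<and>
     (\<forall>z\<in>vsp k. \<forall>t. g (case_option t z) = fst (snd (p g)) + fst (p g) * t + ip k (snd (snd (p g))) z)"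
    unfolding bchoice_iff ..
  define \<alpha> \<beta> a where "\<alpha> g = fst (p g)" and "\<beta> g = fst (snd (p g))" and "a g = snd (snd (p g))" for g
  have a: "a g \<in> vsp k" if "g \<in> F" for g using p that by (simp add: a_def)
  have epi: "f z \<le> ereal t \<longleftrightarrow> (\<forall>g\<in>F. \<beta> g + \<alpha> g * t + ip k (a g) z \<le> 0)" if "z \<in> vsp k" for z t
  proof -
    have "f z \<le> ereal t \<longleftrightarrow> case_option t z \<in> {u. f (\<lambda>i. u (Some i)) \<le> ereal (u None)}" by simp
    also have "\<dots> \<longleftrightarrow> (\<forall>g\<in>F. g (case_option t z) \<le> 0)" unfolding F(3) by blast
    finally show ?thesis using p that by (simp add: \<alpha>_def \<beta>_def a_def)
  qed
  \<comment> \<open>An epigraph is closed upwards, whereas a constraint with positive height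
    coefficient fails for large \<open>t\<close>.\<close>
  have \<alpha>_nonpos: "\<alpha> g \<le> 0" if "g \<in> F" "y \<in> K" for g y
  proof (rule ccontr)
    assume "\<not> \<alpha> g \<le> 0"
    define v where "v = real_of_ereal (f y)"
    have v: "f y = ereal v" using fin[OF \<open>y \<in> K\<close>] by (simp add: v_def ereal_real)
    define t where "t = max v ((1 - \<beta> g - ip k (a g) y) / \<alpha> g)"
    have "f y \<le> ereal t" by (simp add: v t_def)
    then have "\<beta> g + \<alpha> g * t + ip k (a g) y \<le> 0" using epi K(2) that by blast
    moreover have "\<alpha> g * t \<ge> 1 - \<beta> g - ip k (a g) y"
    proof -
      have "(1 - \<beta> g - ip k (a g) y) / \<alpha> g \<le> t" by (simp add: t_def)
      then show ?thesis using \<open>\<not> \<alpha> g \<le> 0\<close> by (simp add: pos_divide_le_eq mult.commute)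
    qed
    ultimately show False by simp
  qed
  have lo_bound: "\<exists>t. \<forall>g\<in>{g\<in>F. \<alpha> g < 0}. (\<beta> g + ip k (a g) z) / (- \<alpha> g) \<le> t" for z
    using ex_between_finite[of "{g\<in>F. \<alpha> g < 0}" "{}" "\<lambda>g. (\<beta> g + ip k (a g) z) / (- \<alpha> g)" "\<lambda>_::unit. 0"] F(1)
    by auto
  \<comment> \<open>Some constraint with \<open>\<alpha> g < 0\<close> is tight at height
    \<open>f y\<close>; otherwise the epigraph would contain a lower point above \<open>y\<close>.
    Its normal vector, scaled to unit height coefficient, is a subgradient.\<close>
  have subgrad: "\<exists>\<sigma>. \<sigma> \<in> vsp k \<and> (\<forall>z\<in>vsp k. \<forall>t. f z \<le> ereal t \<longrightarrow> real_of_ereal (f y) + ip k \<sigma> (\<lambda>i. z i - y i) \<le> t)"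
    if y: "y \<in> K" for y
  proof -
    define v where "v = real_of_ereal (f y)"
    have v: "f y = ereal v" using fin[OF \<open>y \<in> K\<close>] by (simp add: v_def ereal_real)
    have yv: "y \<in> vsp k" using y K(2) by blast
    have cv: "\<beta> g + \<alpha> g * v + ip k (a g) y \<le> 0" if "g \<in> F" for g
      using epi[OF yv, of v] v that by simp
    let ?N = "{g\<in>F. \<alpha> g < 0}" and ?h = "\<lambda>g. (\<beta> g + ip k (a g) y) / (- \<alpha> g)"
    have "\<exists>g\<in>?N. v \<le> ?h g"
    proof (rule ccontr)
      assume "\<not> (\<exists>g\<in>?N. v \<le> ?h g)"
      then have lt: "?h g < v" if "g \<in> ?N" for g using that by force
      obtain s where s: "s < v" "\<And>g. g \<in> ?N \<Longrightarrow> ?h g \<le> s"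
      proof (cases "?N = {}")
        case True
        then show ?thesis using that[of "v - 1"] by auto
      next
        case False
        have "Max (?h ` ?N) \<in> ?h ` ?N" using False F(1) by (intro Max_in) auto
        then have "Max (?h ` ?N) < v" using lt by auto
        then show ?thesis using F(1) by (intro that[of "Max (?h ` ?N)"]) auto
      qed
      have "\<beta> g + \<alpha> g * s + ip k (a g) y \<le> 0" if "g \<in> F" for g
      proof (cases "\<alpha> g < 0")
        case True
        then have "?h g \<le> s" using s that by blast
        then show ?thesis using True by (simp add: pos_divide_le_eq minus_divide_left[symmetric] field_simps)
      next
        case False
        then have "\<alpha> g = 0" using \<alpha>_nonpos[OF that y] by simp
        then show ?thesis using cv[OF that] by simp
      qed
      then have "f y \<le> ereal s" using epi[OF yv] by blast
      then show False using v s(1) by simp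
    qed
    then obtain g where g: "g \<in> F" "\<alpha> g < 0" "v \<le> ?h g" by blast
    define \<sigma> where "\<sigma> = (\<lambda>i. (1 / (- \<alpha> g)) * a g i)"
    have "v + ip k \<sigma> (\<lambda>i. z i - y i) \<le> t" if z: "z \<in> vsp k" "f z \<le> ereal t" for z t
    proof -
      have "\<beta> g + \<alpha> g * t + ip k (a g) z \<le> 0" using epi z g(1) by blast
      then have "(\<beta> g + ip k (a g) z) / (- \<alpha> g) \<le> t" using g(2) by (simp add: field_simps)
      moreover have "?h g + ip k \<sigma> (\<lambda>i. z i - y i) = (\<beta> g + ip k (a g) z) / (- \<alpha> g)"
        unfolding \<sigma>_def ip_scale_left ip_diff_right using g(2) by (simp add: field_simps)
      ultimately show ?thesis using g(3) by linarith
    qed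
    moreover have "\<sigma> \<in> vsp k" using a[OF g(1)] by (simp add: \<sigma>_def vsp_def)
    ultimately show ?thesis unfolding v_def by blast
  qed
  \<comment> \<open>A constraint with \<open>\<alpha> g = 0\<close> cuts out the domain. If it were
    active at \<open>y\<close>, nonnegative multiples of its normal could be added to a subgradient
    without losing the subgradient inequality.\<close>
  have slack: "\<beta> g + ip k (a g) y < 0" if g: "g \<in> F" "\<alpha> g = 0" "i < k" "a g i \<noteq> 0" and y: "y \<in> K" for g y i
  proof (rule ccontr)
    assume neg: "\<not> \<beta> g + ip k (a g) y < 0"
    define v where "v = real_of_ereal (f y)"
    have v: "f y = ereal v" using fin[OF \<open>y \<in> K\<close>] by (simp add: v_def ereal_real)
    have yv: "y \<in> vsp k" using y K(2) by blast
    obtain \<sigma> where \<sigma>: "\<sigma> \<in> vsp k"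
      "\<And>z t. z \<in> vsp k \<Longrightarrow> f z \<le> ereal t \<Longrightarrow> v + ip k \<sigma> (\<lambda>i. z i - y i) \<le> t"
      using subgrad[OF y] unfolding v_def by blast
    have "norm1 k (\<lambda>i. \<sigma> i + s * a g i) \<le> M" if "s \<ge> 0" for s
    proof (rule bnd[OF y])
      have "f y + ereal (ip k (\<lambda>i. \<sigma> i + s * a g i) (\<lambda>i. z i - y i)) \<le> f z" if z: "z \<in> vsp k" for z
      proof (rule ereal_le_real)
        fix t assume t: "f z \<le> ereal t"
        have "\<beta> g + ip k (a g) z \<le> 0" using epi[OF z] t g(1,2) by force
        then have "s * ip k (a g) (\<lambda>i. z i - y i) \<le> 0"
          using neg \<open>s \<ge> 0\<close> unfolding ip_diff_right by (intro mult_nonneg_nonpos) auto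
        then show "f y + ereal (ip k (\<lambda>i. \<sigma> i + s * a g i) (\<lambda>i. z i - y i)) \<le> ereal t"
          using \<sigma>(2)[OF z t] unfolding v ip_add_left by simp
      qed
      then show "is_subgrad k f y (\<lambda>i. \<sigma> i + s * a g i)"
        using yv \<sigma>(1) a[OF g(1)] fin[OF y] by (auto simp: is_subgrad_def vsp_def)
    qed
    \<comment> \<open>With this multiple the added term has absolute value
      \<open>\<bar>M\<bar> + \<bar>\<sigma> i\<bar> + 1\<close> in component \<open>i\<close>, so
      that component alone exceeds \<open>M\<close>.\<close>
    from this[of "(\<bar>M\<bar> + \<bar>\<sigma> i\<bar> + 1) / \<bar>a g i\<bar>"]
    have "norm1 k (\<lambda>j. \<sigma> j + ((\<bar>M\<bar> + \<bar>\<sigma> i\<bar> + 1) / \<bar>a g i\<bar>) * a g j) \<le> M"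
      by (simp add: zero_le_divide_iff)
    moreover have "\<bar>\<sigma> i + ((\<bar>M\<bar> + \<bar>\<sigma> i\<bar> + 1) / \<bar>a g i\<bar>) * a g i\<bar> > M"
      using g(4) by (cases "a g i > 0") auto
    ultimately show False using norm1_component[OF g(3), of "\<lambda>j. \<sigma> j + ((\<bar>M\<bar> + \<bar>\<sigma> i\<bar> + 1) / \<bar>a g i\<bar>) * a g j"] by linarith
  qed
  have "\<exists>\<rho>>0. \<forall>y\<in>K. \<forall>i<k. \<alpha> g = 0 \<longrightarrow> \<beta> g + ip k (a g) y + \<rho> * \<bar>a g i\<bar> \<le> 0" if g: "g \<in> F" for g
  proof (cases "K = {} \<or> \<alpha> g \<noteq> 0")
    case True
    then show ?thesis by (intro exI[of _ 1]) auto
  next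
    case False
    show ?thesis
    \<comment> \<open>If the normal vanishes, \<open>slack\<close> does not apply, but then a shift
      leaves the constraint unchanged and any radius serves.\<close>
    proof (cases "\<forall>i<k. a g i = 0")
      case True
      have "\<beta> g + ip k (a g) y \<le> 0" if y: "y \<in> K" for y
      proof -
        have "f y \<le> ereal (real_of_ereal (f y))" using fin[OF y] by (simp add: ereal_real)
        then show ?thesis using epi[of y] K(2) y g False by force
      qed
      then show ?thesis using True by (intro exI[of _ 1]) auto
    next
      case F: False
      then obtain i0 where i0: "i0 < k" "a g i0 \<noteq> 0" by blast
      obtain y0 where y0: "y0 \<in> K" "\<And>y. y \<in> K \<Longrightarrow> ip k (a g) y \<le> ip k (a g) y0"
        using continuous_attains_sup[OF K(1) _ continuous_on_ip[of K k "a g"]] False by blast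
      \<comment> \<open>The smallest slack over \<open>K\<close>, attained by compactness. Dividing
        it by a bound on the coefficients gives the length of a coordinate step that cannot use it
        up.\<close>
      define \<eta> where "\<eta> = - (\<beta> g + ip k (a g) y0)"
      have "\<eta> > 0" using slack[OF g _ i0 y0(1)] False by (simp add: \<eta>_def)
      define \<rho> where "\<rho> = \<eta> / (norm1 k (a g) + 1)"
      have pos: "norm1 k (a g) + 1 > 0" using norm1_nonneg[of k "a g"] by linarith
      have "\<rho> * \<bar>a g i\<bar> \<le> \<eta>" if "i < k" for i
      proof -
        have "\<rho> * \<bar>a g i\<bar> \<le> \<rho> * (norm1 k (a g) + 1)"
          using norm1_component[OF that, of "a g"] \<open>\<eta> > 0\<close> pos by (intro mult_left_mono) (auto simp: \<rho>_def)
        then show ?thesis using pos by (simp add: \<rho>_def)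
      qed
      then have "\<beta> g + ip k (a g) y + \<rho> * \<bar>a g i\<bar> \<le> 0" if "y \<in> K" "i < k" for y i
        using y0(2)[OF that(1)] that(2) unfolding \<eta>_def by force
      moreover have "\<rho> > 0" using \<open>\<eta> > 0\<close> pos by (simp add: \<rho>_def)
      ultimately show ?thesis by blast
    qed
  qed
  then have "\<forall>g\<in>F. \<exists>\<rho>. \<rho> > 0 \<and> (\<forall>y\<in>K. \<forall>i<k. \<alpha> g = 0 \<longrightarrow> \<beta> g + ip k (a g) y + \<rho> * \<bar>a g i\<bar> \<le> 0)"
    by blast
  then obtain \<rho> where \<rho>: "\<forall>g\<in>F. \<rho> g > 0 \<and> (\<forall>y\<in>K. \<forall>i<k. \<alpha> g = 0 \<longrightarrow> \<beta> g + ip k (a g) y + \<rho> g * \<bar>a g i\<bar> \<le> 0)"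
    unfolding bchoice_iff ..
  \<comment> \<open>The element 1 keeps the minimum defined when there are no constraints.\<close>
  define r where "r = Min (insert 1 (\<rho> ` F))"
  have "r \<in> insert 1 (\<rho> ` F)" unfolding r_def by (rule Min_in) (use F(1) in auto)
  then have r: "r > 0" using \<rho> by auto
  have r_le: "r \<le> \<rho> g" if "g \<in> F" for g unfolding r_def using F(1) that by (intro Min_le) auto
  \<comment> \<open>Constraints with negative height coefficient hold for large \<open>t\<close>;
    only those with \<open>\<alpha> g = 0\<close> restrict the domain, and \<open>\<rho>\<close>
    controls them.\<close>
  have dom: "f (y(i := y i + s)) < \<infinity>" if y: "y \<in> K" and i: "i < k" and s: "\<bar>s\<bar> \<le> r" for y i s
  proof -
    let ?z = "y(i := y i + s)"
    have z: "?z \<in> vsp k" using y K(2) i by (auto simp: vsp_def)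
    obtain t where t: "\<And>g. g \<in> F \<Longrightarrow> \<alpha> g < 0 \<Longrightarrow> (\<beta> g + ip k (a g) ?z) / (- \<alpha> g) \<le> t"
      using lo_bound[of ?z] by blast
    have "\<beta> g + \<alpha> g * t + ip k (a g) ?z \<le> 0" if g: "g \<in> F" for g
    proof (cases "\<alpha> g < 0")
      case True
      then show ?thesis using t[OF g True] by (simp add: field_simps)
    next
      case False
      then have \<alpha>: "\<alpha> g = 0" using \<alpha>_nonpos[OF g y] by simp
      have "a g i * s \<le> \<bar>a g i\<bar> * \<bar>s\<bar>" by (metis abs_ge_self abs_mult)
      also have "\<dots> \<le> \<bar>a g i\<bar> * \<rho> g" using s r_le[OF g] by (intro mult_left_mono) auto
      finally have "\<beta> g + ip k (a g) y + a g i * s \<le> 0" using \<rho> g y i \<alpha>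
        by (smt (verit) mult.commute)
      then show ?thesis using \<alpha> by (simp add: ip_fun_upd[OF i])
    qed
    then have "f ?z \<le> ereal t" using epi[OF z] by blast
    then show ?thesis using le_less_trans less_ereal.simps(4) by blast
  qed
  show ?thesis
  proof (intro exI[of _ r] conjI ballI allI impI r)
    fix z i assume "z \<in> K" "i < k"
    then show "f (z(i := z i + r)) < \<infinity>" "f (z(i := z i - r)) < \<infinity>"
      using dom[of z i r] dom[of z i "- r"] r by auto
  qed
qed

section \<open>Value functions\<close>

locale multistage =
  fixes Q :: "('s::finite, 'w::finite, 'x, 'b) msdata" and x :: 'x and My :: real
  assumes data: "data_ok Q"
    and recourse: "rel_complete_recourse Q x"
    and subgradients: "bounded_subgradients Q x My"
begin

section \<open>Consequences of the standing assumptions\<close>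

lemma nst_ge_2: "nst Q \<ge> 2"
  using data by (simp add: data_ok_def)

lemma ptr_nonneg: "d \<in> {2..nst Q} \<Longrightarrow> ptr Q d l m \<ge> 0"
  and ptr_sum: "d \<in> {2..nst Q} \<Longrightarrow> (\<Sum>m\<in>UNIV. ptr Q d l m) = 1"
  and Yset_vsp: "d \<in> {1..nst Q} \<Longrightarrow> y \<in> Yset Q d \<Longrightarrow> y \<omega> \<in> vsp (dimy Q d)"
  and compact_Ycomp: "d \<in> {1..nst Q} \<Longrightarrow> compact (Ycomp Q d \<omega>)"
  using data by (simp_all add: data_ok_def)

lemma Yset_constraints:
  assumes "d \<in> {1..nst Q}"
  obtains F :: "(('w \<Rightarrow> nat \<Rightarrow> real) \<times> real) set" where "finite F"
    "\<And>y. y \<in> Yset Q d \<longleftrightarrow> (\<forall>\<omega>. y \<omega> \<in> vsp (dimy Q d)) \<and>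
       (\<forall>p\<in>F. (\<Sum>\<omega>\<in>UNIV. ip (dimy Q d) (fst p \<omega>) (y \<omega>)) \<le> snd p)"
proof -
  from data assms have "\<exists>F::(('w \<Rightarrow> nat \<Rightarrow> real) \<times> real) set. finite F \<and>
            Yset Q d = {y. (\<forall>\<omega>. y \<omega> \<in> vsp (dimy Q d)) \<and>
               (\<forall>(a, \<beta>)\<in>F. (\<Sum>\<omega>\<in>UNIV. ip (dimy Q d) (a \<omega>) (y \<omega>)) \<le> \<beta>)}"
    by (simp add: data_ok_def)
  then show ?thesis using that by (auto simp: case_prod_unfold)
qed

lemma feas_Yset: "y \<in> feas Q x d l m z \<Longrightarrow> y \<in> Yset Q d"
  by (simp add: feas_def)

lemma adm_Suc: "y \<in> Yset Q d \<Longrightarrow> y \<omega> \<in> adm Q (Suc d)"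
  by (auto simp: adm_def Ycomp_def)

lemma adm_vsp: "d \<in> {2..nst Q} \<Longrightarrow> z \<in> adm Q d \<Longrightarrow> z \<in> vsp (dimy Q (d - 1))"
  by (auto simp: adm_def Ycomp_def intro!: Yset_vsp)

lemma compact_adm: "d \<in> {2..nst Q} \<Longrightarrow> compact (adm Q d)"
  unfolding adm_def by (intro compact_UN compact_Ycomp) auto

lemma feas_nonempty: "d \<in> {2..nst Q} \<Longrightarrow> z \<in> adm Q d \<Longrightarrow> feas Q x d l m z \<noteq> {}"
  and V_finite: "d \<in> {2..nst Q} \<Longrightarrow> z \<in> adm Q d \<Longrightarrow> \<bar>V Q x d l m z\<bar> \<noteq> \<infinity>"
  using recourse by (simp_all add: rel_complete_recourse_def)

text \<open>The inductive step behind polyhedrality of the value functions: with \<open>R n\<close>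
  the epigraph of a successor's value function and \<open>th\<close> bounding its values, the set is
  the projection of a polyhedron in argument, height, decisions and \<open>th\<close> onto argument
  and height.\<close>

lemma polyhedral_stage:
  fixes R :: "'s \<Rightarrow> (nat option \<Rightarrow> real) set" and q :: "'s \<Rightarrow> real" and l m :: 's
  assumes d: "d \<in> {2..nst Q}" and R: "\<And>n. polyhedral (R n)"
  shows "polyhedral {u. \<exists>y\<in>feas Q x d l m (\<lambda>i. u (Some i)). \<exists>th.
    (\<forall>\<omega> n. case_option (th \<omega> n) (y \<omega>) \<in> R n) \<and>
    (\<Sum>\<omega>\<in>UNIV. pw TYPE('w) * (scost Q d (y \<omega>) + (\<Sum>n\<in>UNIV. q n * th \<omega> n))) \<le> u None}"
    (is "polyhedral ?E")
proof -
  obtain F :: "(('w \<Rightarrow> nat \<Rightarrow> real) \<times> real) set" where F: "finite F"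
    "\<And>y. y \<in> Yset Q d \<longleftrightarrow> (\<forall>\<omega>. y \<omega> \<in> vsp (dimy Q d)) \<and>
       (\<forall>p\<in>F. (\<Sum>\<omega>\<in>UNIV. ip (dimy Q d) (fst p \<omega>) (y \<omega>)) \<le> snd p)"
    using Yset_constraints[of d] d by auto
  \<comment> \<open>All variables share one index type: \<open>Inl\<close> holds height and
    argument, \<open>Inr\<close> the decisions and epigraph variables. Padding with 0 puts
    \<open>Y v\<close> into \<open>vsp\<close> for every \<open>v\<close>, so the infinitely many
    equations defining \<open>vsp\<close> need not be imposed.\<close>
  define Y where "Y = (\<lambda>(v :: nat option + ('w \<times> nat + 'w \<times> 's) \<Rightarrow> real) \<omega> j.
     if j < dimy Q d then v (Inr (Inl (\<omega>, j))) else 0)"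
  define T where "T = (\<lambda>(v :: nat option + ('w \<times> nat + 'w \<times> 's) \<Rightarrow> real) \<omega> n. v (Inr (Inr (\<omega>, n))))"
  define Z where "Z = (\<lambda>(v :: nat option + ('w \<times> nat + 'w \<times> 's) \<Rightarrow> real) i. v (Inl (Some i)))"
  have Y_afun: "(\<lambda>v. Y v \<omega> j) \<in> afun" for \<omega> j
    by (cases "j < dimy Q d") (simp_all add: Y_def afun_const afun_coord)
  have T_afun: "(\<lambda>v. T v \<omega> n) \<in> afun" for \<omega> n
    unfolding T_def by (rule afun_coord)
  have Z_afun: "(\<lambda>v. Z v i) \<in> afun" for i
    unfolding Z_def by (rule afun_coord)
  define P where "P = {v. (\<forall>p\<in>F. v \<in> {v. (\<Sum>\<omega>\<in>UNIV. ip (dimy Q d) (fst p \<omega>) (Y v \<omega>)) \<le> snd p}) \<and>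
    ((\<forall>p\<in>UNIV \<times> {..<dimr Q d}. v \<in> {v. (\<Sum>j<dimy Q d. Am Q d (snd p) j * Y v (fst p) j)
         \<le> Bmap Q d x (bd Q d l m (fst p)) (snd p) + (\<Sum>j<dimy Q (d - 1). Cm Q d (snd p) j * Z v j)}) \<and>
    ((\<forall>\<omega>\<in>UNIV. v \<in> {v. \<forall>n\<in>UNIV. v \<in> {v. (\<lambda>i. (case i of None \<Rightarrow> T v \<omega> n | Some j \<Rightarrow> Y v \<omega> j)) \<in> R n}}) \<and>
     (\<Sum>\<omega>\<in>UNIV. pw TYPE('w) * (scost Q d (Y v \<omega>) + (\<Sum>n\<in>UNIV. q n * T v \<omega> n))) \<le> v (Inl None)))}"
  have P_mem: "v \<in> P \<longleftrightarrow> Y v \<in> feas Q x d l m (Z v) \<and>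
      (\<forall>\<omega> n. case_option (T v \<omega> n) (Y v \<omega>) \<in> R n) \<and>
      (\<Sum>\<omega>\<in>UNIV. pw TYPE('w) * (scost Q d (Y v \<omega>) + (\<Sum>n\<in>UNIV. q n * T v \<omega> n))) \<le> v (Inl None)" for v
  proof -
    have "Y v \<omega> \<in> vsp (dimy Q d)" for \<omega> by (simp add: Y_def vsp_def)
    then show ?thesis using d by (auto simp: P_def feas_def F(2) rhsv_def)
  qed
  have "polyhedral P"
    unfolding P_def
  proof (intro polyhedral_Int polyhedral_INT)
    show "finite F" by (rule F(1))
    show "polyhedral {v. (\<Sum>\<omega>\<in>UNIV. ip (dimy Q d) (fst p \<omega>) (Y v \<omega>)) \<le> snd p}" for p
      by (intro polyhedral_halfspace afun_sum afun_ip Y_afun afun_const)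
    show "polyhedral {v. (\<Sum>j<dimy Q d. Am Q d (snd p) j * Y v (fst p) j)
         \<le> Bmap Q d x (bd Q d l m (fst p)) (snd p) + (\<Sum>j<dimy Q (d - 1). Cm Q d (snd p) j * Z v j)}"
      for p :: "'w \<times> nat"
      by (intro polyhedral_halfspace afun_sum afun_add afun_scale Y_afun Z_afun afun_const)
    show "polyhedral {v. (\<lambda>i. (case i of None \<Rightarrow> T v \<omega> n | Some j \<Rightarrow> Y v \<omega> j)) \<in> R n}" for \<omega> n
    proof (rule polyhedral_comp[OF R])
      show "(\<lambda>v. case i of None \<Rightarrow> T v \<omega> n | Some j \<Rightarrow> Y v \<omega> j) \<in> afun" for i
        by (cases i) (simp_all add: T_afun Y_afun)
    qed
    show "polyhedral {v. (\<Sum>\<omega>\<in>UNIV. pw TYPE('w) * (scost Q d (Y v \<omega>) + (\<Sum>n\<in>UNIV. q n * T v \<omega> n))) \<le> v (Inl None)}"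
      unfolding scost_def
      by (intro polyhedral_halfspace afun_sum afun_scale afun_add afun_ip Y_afun T_afun afun_coord)
  qed auto
  \<comment> \<open>Decision coordinates from \<open>dimy Q d\<close> on are left out, which keeps
    the set of eliminated coordinates finite; they are fixed to 0 instead.\<close>
  define J :: "(nat option + ('w \<times> nat + 'w \<times> 's)) set"
    where "J = Inr ` (Inl ` (UNIV \<times> {..<dimy Q d}) \<union> range Inr)"
  have "finite J" by (simp add: J_def)
  have "polyhedral {u :: nat option \<Rightarrow> real. (\<lambda>i. case i of Inl a \<Rightarrow> u a | Inr b \<Rightarrow> 0) \<in>
     {v. \<exists>w\<in>P. \<forall>i. i \<notin> J \<longrightarrow> w i = v i}}" (is "polyhedral ?E'")
  proof (rule polyhedral_comp[OF polyhedral_project[OF \<open>finite J\<close> \<open>polyhedral P\<close>]])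
    show "(\<lambda>u. case i of Inl a \<Rightarrow> u a | Inr b \<Rightarrow> 0) \<in> afun" for i :: "nat option + ('w \<times> nat + 'w \<times> 's)"
      by (cases i) (simp_all add: afun_coord afun_const)
  qed
  moreover have "?E' = ?E"
  proof
    show "?E' \<subseteq> ?E"
    proof
      fix u assume "u \<in> ?E'"
      then obtain w where w: "w \<in> P" "\<And>i. i \<notin> J \<Longrightarrow> w i = (case i of Inl a \<Rightarrow> u a | Inr b \<Rightarrow> 0)" by blast
      have "w (Inl a) = u a" for a using w(2)[of "Inl a"] by (auto simp: J_def)
      then have "Z w = (\<lambda>i. u (Some i))" "w (Inl None) = u None" by (auto simp: Z_def)
      then show "u \<in> ?E" using w(1) unfolding P_mem by auto
    qed
    show "?E \<subseteq> ?E'"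
    proof
      fix u assume "u \<in> ?E"
      then obtain y th where y: "y \<in> feas Q x d l m (\<lambda>i. u (Some i))"
        and th: "\<And>\<omega> n. case_option (th \<omega> n) (y \<omega>) \<in> R n"
        "(\<Sum>\<omega>\<in>UNIV. pw TYPE('w) * (scost Q d (y \<omega>) + (\<Sum>n\<in>UNIV. q n * th \<omega> n))) \<le> u None" by blast
      define w where "w = case_sum u (case_sum (\<lambda>(\<omega>, j). if j < dimy Q d then y \<omega> j else 0) (\<lambda>(\<omega>, n). th \<omega> n))"
      have "y \<omega> \<in> vsp (dimy Q d)" for \<omega> using Yset_vsp feas_Yset y d by auto
      then have "Y w = y" by (auto simp: Y_def w_def fun_eq_iff vsp_def)
      moreover have "T w = th" "Z w = (\<lambda>i. u (Some i))" "w (Inl None) = u None"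
        by (auto simp: T_def Z_def w_def)
      ultimately have "w \<in> P" using y th unfolding P_mem by simp
      moreover have "w i = (case i of Inl a \<Rightarrow> u a | Inr b \<Rightarrow> 0)" if "i \<notin> J" for i
        using that by (auto simp: w_def J_def split: sum.splits)
      ultimately show "u \<in> ?E'" by blast
    qed
  qed
  ultimately show ?thesis by simp
qed

section \<open>Recursion for the value functions and polyhedrality of their epigraphs\<close>

lemma V_last: "V Q x (nst Q) l m z =
    (INF y\<in>feas Q x (nst Q) l m z. ereal (\<Sum>\<omega>\<in>UNIV. pw TYPE('w) * scost Q (nst Q) (y \<omega>)))"
  by (simp add: V_def)

text \<open>Feasible decisions are admissible arguments of the next stage, where recourse makes the
  value functions finite. Hence the extended-real recursion can be carried out in the reals.\<close>

lemma V_step: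
  assumes "1 \<le> d" "d < nst Q"
  shows "V Q x d l m z = (INF y\<in>feas Q x d l m z. ereal (\<Sum>\<omega>\<in>UNIV. pw TYPE('w) *
     (scost Q d (y \<omega>) + (\<Sum>n\<in>UNIV. ptr Q (d + 1) m n * real_of_ereal (V Q x (d + 1) m n (y \<omega>))))))"
proof -
  have k: "nst Q - d = Suc (nst Q - (d + 1))" using assms(2) by simp
  show ?thesis unfolding V_def[of Q x d] k Vk.simps V_def[symmetric]
  proof (intro INF_cong refl)
    fix y assume y: "y \<in> feas Q x d l m z"
    define r where "r = (\<lambda>\<omega> n. real_of_ereal (V Q x (d + 1) m n (y \<omega>)))"
    have r: "V Q x (d + 1) m n (y \<omega>) = ereal (r \<omega> n)" for \<omega> n
      using V_finite[of "d + 1" "y \<omega>" m n] adm_Suc[OF feas_Yset[OF y], of \<omega>] assms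
      by (simp add: r_def ereal_real)
    show "(\<Sum>\<omega>\<in>UNIV. ereal (pw TYPE('w)) * (ereal (scost Q d (y \<omega>)) +
         (\<Sum>n\<in>UNIV. ereal (ptr Q (d + 1) m n) * V Q x (d + 1) m n (y \<omega>)))) =
       ereal (\<Sum>\<omega>\<in>UNIV. pw TYPE('w) * (scost Q d (y \<omega>) +
         (\<Sum>n\<in>UNIV. ptr Q (d + 1) m n * real_of_ereal (V Q x (d + 1) m n (y \<omega>)))))"
      by (simp add: r[simplified])
  qed
qed

lemma V_infeasible: "1 \<le> d \<Longrightarrow> d \<le> nst Q \<Longrightarrow> feas Q x d l m z = {} \<Longrightarrow> V Q x d l m z = \<infinity>"
  using V_last V_step[of d l m z] by (cases "d = nst Q") (auto simp: top_ereal_def)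

lemma pw_nonneg: "pw TYPE('w) \<ge> 0"
  by (simp add: pw_def)

lemma sum_pw: "(\<Sum>\<omega>\<in>(UNIV::'w set). pw TYPE('w)) = 1"
  by (simp add: pw_def)

text \<open>Backward induction over the stages. Since the weights are nonnegative, replacing
  successor values by upper bounds \<open>th\<close> does not lower the objective, so the projected
  set matches the epigraph.\<close>

lemma polyhedral_V:
  assumes "d \<in> {2..nst Q}"
  shows "polyhedral {u. V Q x d l m (\<lambda>i. u (Some i)) \<le> ereal (u None)}"
  using assms
proof (induction "nst Q - d" arbitrary: d l m)
  case 0
  then have d: "d = nst Q" by simp
  \<comment> \<open>The last stage has no successors: \<open>UNIV\<close> and weight 0 make the
    epigraph variables irrelevant.\<close>
  note E = polyhedral_stage[OF "0.prems", where R = "\<lambda>_. UNIV" and l = l and m = m and q = "\<lambda>_. 0"]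
  have U: "polyhedral (UNIV :: (nat option \<Rightarrow> real) set)"
    unfolding polyhedral_def by (rule exI[of _ "{}"]) auto
  show ?case
    apply (subst epigraph_eqI[OF E[OF U], symmetric])
    subgoal by (auto simp: d V_last intro!: INF_lower2)
    subgoal by (auto simp: d V_last INF_less_iff intro!: bexI less_imp_le)
    subgoal by (rule E[OF U])
    done
next
  case (Suc k)
  then have d: "d < nst Q" "1 \<le> d" by auto
  have IH: "polyhedral {u. V Q x (d + 1) m n (\<lambda>i. u (Some i)) \<le> ereal (u None)}" for n
    using Suc.hyps(1)[of "d + 1"] Suc.hyps(2) Suc.prems d by auto
  note E = polyhedral_stage[OF Suc.prems IH, where l = l and m = m and q = "ptr Q (d + 1) m"]
  have fin: "V Q x (d + 1) m n (y \<omega>) = ereal (real_of_ereal (V Q x (d + 1) m n (y \<omega>)))"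
    if "y \<in> feas Q x d l m z" for y z \<omega> n
    using V_finite[of "d + 1" "y \<omega>" m n] adm_Suc[OF feas_Yset[OF that], of \<omega>] d
    by (simp add: ereal_real)
  show ?case
  proof (subst epigraph_eqI[OF E, symmetric])
    fix u assume "u \<in> {u. \<exists>y\<in>feas Q x d l m (\<lambda>i. u (Some i)). \<exists>th.
      (\<forall>\<omega> n. case_option (th \<omega> n) (y \<omega>) \<in> {u. V Q x (d + 1) m n (\<lambda>i. u (Some i)) \<le> ereal (u None)}) \<and>
      (\<Sum>\<omega>\<in>UNIV. pw TYPE('w) * (scost Q d (y \<omega>) + (\<Sum>n\<in>UNIV. ptr Q (d + 1) m n * th \<omega> n))) \<le> u None}"
    then obtain y th where y: "y \<in> feas Q x d l m (\<lambda>i. u (Some i))"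
      and th: "\<And>\<omega> n. V Q x (d + 1) m n (y \<omega>) \<le> ereal (th \<omega> n)"
      "(\<Sum>\<omega>\<in>UNIV. pw TYPE('w) * (scost Q d (y \<omega>) + (\<Sum>n\<in>UNIV. ptr Q (d + 1) m n * th \<omega> n))) \<le> u None"
      by auto
    have "real_of_ereal (V Q x (d + 1) m n (y \<omega>)) \<le> th \<omega> n" for \<omega> n
      using th(1)[of n \<omega>] fin[OF y, of n \<omega>] by (metis ereal_less_eq(3))
    then have "(\<Sum>\<omega>\<in>UNIV. pw TYPE('w) * (scost Q d (y \<omega>) + (\<Sum>n\<in>UNIV. ptr Q (d + 1) m n * real_of_ereal (V Q x (d + 1) m n (y \<omega>))))) \<le>
      (\<Sum>\<omega>\<in>UNIV. pw TYPE('w) * (scost Q d (y \<omega>) + (\<Sum>n\<in>UNIV. ptr Q (d + 1) m n * th \<omega> n)))"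
      using d by (intro sum_mono mult_left_mono add_left_mono pw_nonneg ptr_nonneg) auto
    then show "V Q x d l m (\<lambda>i. u (Some i)) \<le> ereal (u None)"
      unfolding V_step[OF d(2,1)] using th(2) y by (intro INF_lower2[OF y]) auto
  next
    fix u assume "V Q x d l m (\<lambda>i. u (Some i)) < ereal (u None)"
    then obtain y where y: "y \<in> feas Q x d l m (\<lambda>i. u (Some i))"
      "(\<Sum>\<omega>\<in>UNIV. pw TYPE('w) * (scost Q d (y \<omega>) + (\<Sum>n\<in>UNIV. ptr Q (d + 1) m n * real_of_ereal (V Q x (d + 1) m n (y \<omega>))))) < u None"
      unfolding V_step[OF d(2,1)] INF_less_iff by auto
    then show "u \<in> {u. \<exists>y\<in>feas Q x d l m (\<lambda>i. u (Some i)). \<exists>th.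
      (\<forall>\<omega> n. case_option (th \<omega> n) (y \<omega>) \<in> {u. V Q x (d + 1) m n (\<lambda>i. u (Some i)) \<le> ereal (u None)}) \<and>
      (\<Sum>\<omega>\<in>UNIV. pw TYPE('w) * (scost Q d (y \<omega>) + (\<Sum>n\<in>UNIV. ptr Q (d + 1) m n * th \<omega> n))) \<le> u None}"
      using eq_refl[OF fin[OF y(1)]]
      by (intro CollectI bexI[OF _ y(1)] exI[of _ "\<lambda>\<omega> n. real_of_ereal (V Q x (d + 1) m n (y \<omega>))"]) auto
  qed (rule E)
qed

end

section \<open>Bounds for the approximating problems\<close>

context multistage
begin

text \<open>Carries the domain margin from the true value functions to feasibility. The
  approximating problems have the same feasible decisions, so the margin serves them too, with a
  radius independent of the cuts.\<close>

lemma feas_margin: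
  assumes d: "d \<in> {2..nst Q}"
  shows "\<exists>r>0. \<forall>z\<in>adm Q d. \<forall>i<dimy Q (d - 1).
     feas Q x d l m (z(i := z i + r)) \<noteq> {} \<and> feas Q x d l m (z(i := z i - r)) \<noteq> {}"
proof -
  have "\<exists>r>0. \<forall>z\<in>adm Q d. \<forall>i<dimy Q (d - 1).
     V Q x d l m (z(i := z i + r)) < \<infinity> \<and> V Q x d l m (z(i := z i - r)) < \<infinity>"
  proof (rule polyhedral_domain_margin[OF polyhedral_V[OF d] compact_adm[OF d]])
    show "adm Q d \<subseteq> vsp (dimy Q (d - 1))" using adm_vsp[OF d] by blast
    show "norm1 (dimy Q (d - 1)) \<sigma> \<le> My"
      if "z \<in> adm Q d" "is_subgrad (dimy Q (d - 1)) (V Q x d l m) z \<sigma>" for z \<sigma>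
      using subgradients d that by (simp add: bounded_subgradients_def)
  qed (rule V_finite[OF d])
  moreover have "feas Q x d l m z \<noteq> {}" if "V Q x d l m z < \<infinity>" for z
    using V_infeasible[of d l m z] d that by auto
  ultimately show ?thesis by blast
qed

section \<open>Uniform bounds on decisions and objectives\<close>

lemma Yset_bounded:
  assumes "d \<in> {1..nst Q}"
  shows "\<exists>R. \<forall>y\<in>Yset Q d. \<forall>\<omega> i. \<bar>y \<omega> i\<bar> \<le> R"
proof -
  let ?A = "\<Union>\<omega>. Ycomp Q d \<omega>"
  have "compact ?A" using compact_Ycomp[OF assms] by (intro compact_UN) auto
  have "\<exists>R. \<forall>z\<in>?A. \<bar>z i\<bar> \<le> R" for i
  proof -
    have "continuous_on ?A (\<lambda>z. z i)"
      by (rule continuous_on_subset[OF continuous_on_product_coordinates]) auto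
    from compact_imp_bounded[OF compact_continuous_image[OF this \<open>compact ?A\<close>]]
    show ?thesis unfolding bounded_iff by auto
  qed
  then obtain R where R: "\<And>i z. z \<in> ?A \<Longrightarrow> \<bar>z i\<bar> \<le> R i" by metis
  have "\<bar>y \<omega> i\<bar> \<le> (\<Sum>i<dimy Q d. \<bar>R i\<bar>)" if y: "y \<in> Yset Q d" for y \<omega> i
  proof (cases "i < dimy Q d")
    case True
    have "\<bar>y \<omega> i\<bar> \<le> R i" using R y by (auto simp: Ycomp_def)
    also have "\<dots> \<le> \<bar>R i\<bar>" by simp
    also have "\<dots> \<le> (\<Sum>i<dimy Q d. \<bar>R i\<bar>)" using True by (intro member_le_sum) auto
    finally show ?thesis .
  next
    case False
    then have "y \<omega> i = 0" using Yset_vsp[OF assms y, of \<omega>] by (simp add: vsp_def)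
    then show ?thesis by (simp add: sum_nonneg)
  qed
  then show ?thesis by blast
qed

lemma ip_Yset_bounded:
  assumes "d \<in> {1..nst Q}"
  shows "\<exists>R. \<forall>y\<in>Yset Q d. \<forall>\<omega>. \<bar>ip (dimy Q d) a (y \<omega>)\<bar> \<le> R"
proof -
  obtain R where R: "\<forall>y\<in>Yset Q d. \<forall>\<omega> i. \<bar>y \<omega> i\<bar> \<le> R" using Yset_bounded[OF assms] by blast
  have "\<bar>ip (dimy Q d) a (y \<omega>)\<bar> \<le> R * norm1 (dimy Q d) a" if "y \<in> Yset Q d" for y \<omega>
    unfolding ip_commute[of _ a] by (rule abs_ip_le) (use R that in auto)
  then show ?thesis by blast
qed

text \<open>Scenario weights and transition probabilities both sum to one, so a uniform shift of the
  successor values passes to the objective unchanged. Successors of probability zero contribute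
  nothing, in accordance with the restricted argmax of the forward pass.\<close>

lemma aobj_mono:
  assumes d: "d \<in> {1..<nst Q}"
    and "\<And>\<omega> n. ptr Q (d + 1) m n > 0 \<Longrightarrow> th' \<omega> n \<le> th \<omega> n + c"
  shows "aobj Q d m y th' \<le> aobj Q d m y th + c"
proof -
  have "(\<Sum>n\<in>UNIV. ptr Q (d + 1) m n * th' \<omega> n) \<le> (\<Sum>n\<in>UNIV. ptr Q (d + 1) m n * th \<omega> n) + c" for \<omega>
  proof -
    have "ptr Q (d + 1) m n * th' \<omega> n \<le> ptr Q (d + 1) m n * (th \<omega> n + c)" for n
      using assms(2)[of n \<omega>] ptr_nonneg[of "d + 1" m n] d
      by (cases "ptr Q (d + 1) m n = 0") (auto intro!: mult_left_mono)
    then have "(\<Sum>n\<in>UNIV. ptr Q (d + 1) m n * th' \<omega> n) \<le> (\<Sum>n\<in>UNIV. ptr Q (d + 1) m n * (th \<omega> n + c))"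
      by (intro sum_mono)
    also have "\<dots> = (\<Sum>n\<in>UNIV. ptr Q (d + 1) m n * th \<omega> n) + c"
      using ptr_sum[of "d + 1" m] d by (simp add: distrib_left sum.distrib flip: sum_distrib_right)
    finally show ?thesis .
  qed
  then have "aobj Q d m y th' \<le> (\<Sum>\<omega>\<in>UNIV. pw TYPE('w) * (scost Q d (y \<omega>) +
       (\<Sum>n\<in>UNIV. ptr Q (d + 1) m n * th \<omega> n)) + pw TYPE('w) * c)"
    unfolding aobj_def distrib_left[symmetric] using d pw_nonneg
    by (intro sum_mono mult_left_mono) (auto simp: add.assoc)
  also have "\<dots> = aobj Q d m y th + c"
    using d sum_pw by (simp add: aobj_def sum.distrib flip: sum_distrib_right)
  finally show ?thesis .
qed

text \<open>Isolates the effect of one epigraph variable, for arguments that perturb an optimal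
  solution in a single component.\<close>

lemma aobj_fun_upd:
  assumes "d < nst Q"
  shows "aobj Q d m y (th(\<omega> := (th \<omega>)(n := v))) =
    aobj Q d m y th + pw TYPE('w) * ptr Q (d + 1) m n * (v - th \<omega> n)"
proof -
  let ?th = "th(\<omega> := (th \<omega>)(n := v))"
  have inner: "(\<Sum>n'\<in>UNIV. ptr Q (d + 1) m n' * ?th \<omega>' n') = (\<Sum>n'\<in>UNIV. ptr Q (d + 1) m n' * th \<omega>' n') +
     (if \<omega>' = \<omega> then ptr Q (d + 1) m n * (v - th \<omega> n) else 0)" for \<omega>'
  proof -
    have "(\<Sum>n'\<in>UNIV. ptr Q (d + 1) m n' * ?th \<omega>' n') = (\<Sum>n'\<in>UNIV. ptr Q (d + 1) m n' * th \<omega>' n' +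
       (if n' = n then (if \<omega>' = \<omega> then ptr Q (d + 1) m n * (v - th \<omega> n) else 0) else 0))"
      by (intro sum.cong) (auto simp: algebra_simps)
    then show ?thesis by (simp add: sum.distrib)
  qed
  have "aobj Q d m y ?th = (\<Sum>\<omega>'\<in>UNIV. pw TYPE('w) * (scost Q d (y \<omega>') + (\<Sum>n'\<in>UNIV. ptr Q (d + 1) m n' * th \<omega>' n')) +
     (if \<omega>' = \<omega> then pw TYPE('w) * (ptr Q (d + 1) m n * (v - th \<omega> n)) else 0))"
    unfolding aobj_def inner using assms by (intro sum.cong) (auto simp: algebra_simps)
  then show ?thesis using assms by (simp add: aobj_def sum.distrib)
qed

lemma aobj_const_bounded:
  assumes "d \<in> {1..nst Q}"
  shows "\<exists>S. \<forall>y\<in>Yset Q d. \<forall>m c. \<bar>aobj Q d m y (\<lambda>_ _. c)\<bar> \<le> S + \<bar>c\<bar>"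
proof -
  obtain S where S: "\<forall>y\<in>Yset Q d. \<forall>\<omega>. \<bar>scost Q d (y \<omega>)\<bar> \<le> S"
    using ip_Yset_bounded[OF assms, of "cost Q d"] unfolding scost_def by blast
  have "\<bar>aobj Q d m y (\<lambda>_ _. c)\<bar> \<le> S + \<bar>c\<bar>" if y: "y \<in> Yset Q d" for y m c
  proof -
    let ?e = "if d < nst Q then c else 0"
    have "(\<Sum>n\<in>UNIV. ptr Q (d + 1) m n * c) = c" if "d < nst Q"
      using ptr_sum[of "d + 1" m] assms that by (simp flip: sum_distrib_right)
    then have "aobj Q d m y (\<lambda>_ _. c) = (\<Sum>\<omega>\<in>UNIV. pw TYPE('w) * (scost Q d (y \<omega>) + ?e))"
      unfolding aobj_def by (intro sum.cong) auto
    then have "\<bar>aobj Q d m y (\<lambda>_ _. c)\<bar> \<le> (\<Sum>\<omega>\<in>UNIV. \<bar>pw TYPE('w) * (scost Q d (y \<omega>) + ?e)\<bar>)"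
      by (metis sum_abs)
    also have "\<dots> \<le> (\<Sum>\<omega>\<in>(UNIV::'w set). pw TYPE('w) * (S + \<bar>c\<bar>))"
    proof (rule sum_mono)
      fix \<omega> :: 'w
      have "\<bar>scost Q d (y \<omega>) + ?e\<bar> \<le> S + \<bar>c\<bar>" using abs_triangle_ineq[of "scost Q d (y \<omega>)" ?e] S[rule_format, OF y, of \<omega>]
        by (auto split: if_splits)
      then show "\<bar>pw TYPE('w) * (scost Q d (y \<omega>) + ?e)\<bar> \<le> pw TYPE('w) * (S + \<bar>c\<bar>)"
        using pw_nonneg by (simp add: abs_mult mult_left_mono)
    qed
    also have "\<dots> = S + \<bar>c\<bar>" using sum_pw by (simp flip: sum_distrib_right)
    finally show ?thesis .
  qed
  then show ?thesis by blast
qed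

section \<open>Bounds on the values and slopes of the approximating problems\<close>

lemma LPfeas_cut:
  assumes "(y, th) \<in> LPfeas Q x LC d l m z" "d < nst Q" "(\<theta>, \<sigma>, s) \<in> LC (ckey d l m) n"
  shows "\<theta> + ip (dimy Q d) \<sigma> (\<lambda>i. y \<omega> i - s i) \<le> th \<omega> n"
  using assms unfolding LPfeas_def by fastforce

lemma LPfeas_Yset: "(y, th) \<in> LPfeas Q x LC d l m z \<Longrightarrow> y \<in> Yset Q d"
  by (auto simp: LPfeas_def feas_def)

lemma LPfeas_antimono:
  assumes "\<And>\<kappa> n. LC \<kappa> n \<subseteq> LC' \<kappa> n"
  shows "LPfeas Q x LC' d l m z \<subseteq> LPfeas Q x LC d l m z"
  using assms unfolding LPfeas_def by blast

lemma LPval_mono: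
  assumes "\<And>\<kappa> n. LC \<kappa> n \<subseteq> LC' \<kappa> n"
  shows "LPval Q x LC d l m z \<le> LPval Q x LC' d l m z"
  unfolding LPval_def by (rule INF_superset_mono[OF LPfeas_antimono[OF assms] order_refl])

lemma LPval_le: "(y, th) \<in> LPfeas Q x LC d l m z \<Longrightarrow> LPval Q x LC d l m z \<le> ereal (aobj Q d m y th)"
  unfolding LPval_def by (rule INF_lower2) auto

lemma UPval_le: "(y, th, \<gamma>, \<mu>) \<in> UPfeas Q x My UC d l m z \<Longrightarrow> UPval Q x My UC d l m z \<le> ereal (aobj Q d m y th)"
  unfolding UPval_def by (rule INF_lower2) auto

lemma LPval_eq: "LPopt Q x LC d l m z y th \<Longrightarrow> LPval Q x LC d l m z = ereal (aobj Q d m y th)"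
  unfolding LPopt_def LPval_def by (intro antisym INF_lower2 INF_greatest) auto

text \<open>An optimal solution can only exist if each successor state of positive probability has a
  cut, since otherwise its epigraph variable could be decreased without limit.\<close>

lemma LPval_bounded_below:
  assumes d: "d \<in> {1..nst Q}" and opt: "LPopt Q x LC d l m z0 y0 th0"
  shows "\<exists>L. \<forall>z. ereal L \<le> LPval Q x LC d l m z"
proof -
  obtain S where S: "\<And>y m c. y \<in> Yset Q d \<Longrightarrow> \<bar>aobj Q d m y (\<lambda>_ _. c)\<bar> \<le> S + \<bar>c\<bar>"
    using aobj_const_bounded[OF d] by blast
  have "\<exists>e. \<forall>z y th. (y, th) \<in> LPfeas Q x LC d l m z \<longrightarrow> aobj Q d m y (\<lambda>_ _. 0) \<le> aobj Q d m y th + e"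
  proof (cases "d < nst Q")
    case False
    then show ?thesis by (intro exI[of _ 0]) (auto simp: aobj_def)
  next
    case True
    have "\<exists>e. \<forall>z y th \<omega>. (y, th) \<in> LPfeas Q x LC d l m z \<longrightarrow> ptr Q (d + 1) m n > 0 \<longrightarrow> 0 \<le> th \<omega> n + e" for n
    proof (cases "ptr Q (d + 1) m n > 0")
      case False
      then show ?thesis by auto
    next
      case pos: True
      have "LC (ckey d l m) n \<noteq> {}"
      proof
        assume empty: "LC (ckey d l m) n = {}"
        fix \<omega> :: 'w
        let ?th = "th0(\<omega> := (th0 \<omega>)(n := th0 \<omega> n - 1))"
        have "(y0, ?th) \<in> LPfeas Q x LC d l m z0"
          using opt empty by (auto simp: LPopt_def LPfeas_def)
        then have "aobj Q d m y0 th0 \<le> aobj Q d m y0 ?th" using opt by (auto simp: LPopt_def)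
        then have "pw TYPE('w) * ptr Q (d + 1) m n \<le> 0" by (simp add: aobj_fun_upd[OF True])
        moreover have "pw TYPE('w) * ptr Q (d + 1) m n > 0" using pos by (simp add: pw_def)
        ultimately show False by linarith
      qed
      then obtain \<theta> \<sigma> s where cut: "(\<theta>, \<sigma>, s) \<in> LC (ckey d l m) n" by auto
      obtain R where R: "\<forall>y\<in>Yset Q d. \<forall>\<omega>. \<bar>ip (dimy Q d) \<sigma> (y \<omega>)\<bar> \<le> R"
        using ip_Yset_bounded[OF d] by blast
      have "0 \<le> th \<omega> n + (R - \<theta> + ip (dimy Q d) \<sigma> s)" if "(y, th) \<in> LPfeas Q x LC d l m z" for z y th \<omega>
      proof -
        have "\<theta> + ip (dimy Q d) \<sigma> (\<lambda>i. y \<omega> i - s i) \<le> th \<omega> n" "y \<in> Yset Q d"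
          using LPfeas_cut[OF that True cut] LPfeas_Yset[OF that] by auto
        then show ?thesis using R unfolding ip_diff_right by (smt (verit, best))
      qed
      then show ?thesis by blast
    qed
    then obtain e where e: "\<And>n z y th \<omega>. (y, th) \<in> LPfeas Q x LC d l m z \<Longrightarrow> ptr Q (d + 1) m n > 0 \<Longrightarrow> 0 \<le> th \<omega> n + e n"
      by metis
    have "aobj Q d m y (\<lambda>_ _. 0) \<le> aobj Q d m y th + Max (range e)" if "(y, th) \<in> LPfeas Q x LC d l m z" for z y th
    proof (rule aobj_mono)
      show "d \<in> {1..<nst Q}" using d True by simp
      show "0 \<le> th \<omega> n + Max (range e)" if "ptr Q (d + 1) m n > 0" for \<omega> n
      proof -
        have "e n \<le> Max (range e)" by (rule Max_ge) auto
        then show ?thesis using e[OF \<open>(y, th) \<in> LPfeas Q x LC d l m z\<close> that, of \<omega>] by linarith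
      qed
    qed
    then show ?thesis by blast
  qed
  then obtain e where e: "\<And>z y th. (y, th) \<in> LPfeas Q x LC d l m z \<Longrightarrow> aobj Q d m y (\<lambda>_ _. 0) \<le> aobj Q d m y th + e"
    by blast
  have "ereal (- S - e) \<le> LPval Q x LC d l m z" for z
    unfolding LPval_def
  proof (rule INF_greatest, clarify)
    fix y th assume f: "(y, th) \<in> LPfeas Q x LC d l m z"
    then have "y \<in> Yset Q d" by (rule LPfeas_Yset)
    then show "ereal (- S - e) \<le> ereal (aobj Q d m y th)" using S[of y m 0] e[OF f] by simp
  qed
  then show ?thesis by blast
qed

text \<open>Over-approximates the lower cut collections that occur in runs started with \<open>LC0\<close>.\<close>

inductive reach :: "'s lcuts \<Rightarrow> 's lcuts \<Rightarrow> bool" for LC0 where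
  reach_init: "reach LC0 LC0"
| reach_cut: "reach LC0 LC \<Longrightarrow> d \<in> {2..nst Q} \<Longrightarrow> LPval Q x LC d l m z = ereal \<theta> \<Longrightarrow>
    is_subgrad (dimy Q (d - 1)) (LPval Q x LC d l m) z \<sigma> \<Longrightarrow>
    reach LC0 (LC(ckey (d - 1) l0 l := (LC (ckey (d - 1) l0 l))(m :=
      insert (\<theta>, \<sigma>, z) (LC (ckey (d - 1) l0 l) m))))"

lemma reach_finite: "reach LC0 LC \<Longrightarrow> \<forall>\<kappa> n. finite (LC0 \<kappa> n) \<Longrightarrow> finite (LC \<kappa> n)"
  by (induction arbitrary: \<kappa> n rule: reach.induct) auto

lemma LPval_less_top:
  assumes "feas Q x d l m z \<noteq> {}" "\<And>\<kappa> n. finite (LC \<kappa> n)"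
  shows "LPval Q x LC d l m z < \<infinity>"
proof -
  obtain y where y: "y \<in> feas Q x d l m z" using assms(1) by blast
  let ?cut = "\<lambda>\<omega> (\<theta>, \<sigma>, s). \<theta> + ip (dimy Q d) \<sigma> (\<lambda>i. y \<omega> i - s i)"
  \<comment> \<open>The sum of absolute values dominates every cut and also makes sense for an empty
    collection.\<close>
  define th where "th \<omega> n = (\<Sum>c\<in>LC (ckey d l m) n. \<bar>?cut \<omega> c\<bar>)" for \<omega> n
  have "?cut \<omega> c \<le> th \<omega> n" if "c \<in> LC (ckey d l m) n" for \<omega> n c
  proof -
    have "?cut \<omega> c \<le> \<bar>?cut \<omega> c\<bar>" by simp
    also have "\<dots> \<le> th \<omega> n" unfolding th_def by (rule member_le_sum) (use assms(2) that in auto)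
    finally show ?thesis .
  qed
  then have "(y, th) \<in> LPfeas Q x LC d l m z" using y by (fastforce simp: LPfeas_def)
  from LPval_le[OF this] show ?thesis using le_less_trans less_ereal.simps(4) by blast
qed

text \<open>Initial cuts may lie above the true value functions, so \<open>V\<close> does not
  provide the bound. Instead, backward induction bounds all cuts: a generated cut lies below the
  next-stage approximation it was taken from, which is bounded by the induction hypothesis, and the
  finitely many initial cuts are bounded on bounded sets. A constant epigraph variable is then
  feasible. The bound is uniform in \<open>LC\<close>.\<close>

lemma LPval_bounded_above:
  assumes fin: "\<forall>\<kappa> n. finite (LC0 \<kappa> n)" and d: "d \<in> {2..nst Q}"
  shows "\<exists>B. \<forall>LC l m z. reach LC0 LC \<longrightarrow> feas Q x d l m z \<noteq> {} \<longrightarrow> LPval Q x LC d l m z \<le> ereal B"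
  using d
proof (induction "nst Q - d" arbitrary: d)
  case 0
  then have dn: "d = nst Q" "d \<in> {1..nst Q}" by auto
  obtain S where S: "\<And>y m c. y \<in> Yset Q d \<Longrightarrow> \<bar>aobj Q d m y (\<lambda>_ _. c)\<bar> \<le> S + \<bar>c\<bar>"
    using aobj_const_bounded[OF dn(2)] by blast
  have "LPval Q x LC d l m z \<le> ereal S" if "feas Q x d l m z \<noteq> {}" for LC l m z
  proof -
    obtain y where y: "y \<in> feas Q x d l m z" using \<open>feas Q x d l m z \<noteq> {}\<close> by blast
    have "(y, \<lambda>_ _. 0) \<in> LPfeas Q x LC d l m z" using y dn by (simp add: LPfeas_def)
    from LPval_le[OF this] show ?thesis using S[OF feas_Yset[OF y], of m 0]
      by (auto intro: order_trans)
  qed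
  then show ?case by blast
next
  case (Suc k)
  then have dn: "d < nst Q" "d \<in> {1..nst Q}" "d + 1 \<in> {2..nst Q}" by auto
  obtain S where S: "\<And>y m c. y \<in> Yset Q d \<Longrightarrow> \<bar>aobj Q d m y (\<lambda>_ _. c)\<bar> \<le> S + \<bar>c\<bar>"
    using aobj_const_bounded[OF dn(2)] by blast
  obtain B where B: "\<And>LC l m z. reach LC0 LC \<Longrightarrow> feas Q x (d + 1) l m z \<noteq> {} \<Longrightarrow> LPval Q x LC (d + 1) l m z \<le> ereal B"
  proof -
    have "k = nst Q - (d + 1)" using Suc.hyps(2) by simp
    from Suc.hyps(1)[OF this dn(3)] that show thesis by blast
  qed
  let ?k = "dimy Q d"
  let ?cut = "\<lambda>(\<theta>, \<sigma>, s) z. \<theta> + ip ?k \<sigma> (\<lambda>i. z i - s i)"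
  define A where "A = (\<Union>l. \<Union>m. \<Union>n. LC0 (ckey d l m) n)"
  have "finite A" unfolding A_def by (intro finite_UN_I fin[rule_format]) simp_all
  have "\<exists>b. \<forall>z\<in>adm Q (d + 1). ?cut c z \<le> b" for c
  proof -
    obtain \<theta> \<sigma> s where c: "c = (\<theta>, \<sigma>, s)" by (cases c)
    obtain R where R: "\<And>y \<omega>. y \<in> Yset Q d \<Longrightarrow> \<bar>ip ?k \<sigma> (y \<omega>)\<bar> \<le> R"
      using ip_Yset_bounded[OF dn(2)] by blast
    have "?cut c z \<le> \<theta> + R - ip ?k \<sigma> s" if "z \<in> adm Q (d + 1)" for z
    proof -
      obtain y \<omega> where "y \<in> Yset Q d" "z = y \<omega>" using \<open>z \<in> adm Q (d + 1)\<close> by (auto simp: adm_def Ycomp_def)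
      then show ?thesis using R[of y \<omega>] by (simp add: c ip_diff_right)
    qed
    then show ?thesis by blast
  qed
  then have "\<forall>c. \<exists>b. \<forall>z\<in>adm Q (d + 1). ?cut c z \<le> b" by (rule allI)
  then obtain b where "\<forall>c. \<forall>z\<in>adm Q (d + 1). ?cut c z \<le> b c" unfolding choice_iff ..
  then have b: "\<And>c z. z \<in> adm Q (d + 1) \<Longrightarrow> ?cut c z \<le> b c" by blast
  define C where "C = max B (\<Sum>c\<in>A. \<bar>b c\<bar>)"
  have cuts: "?cut c z \<le> C" if "reach LC0 LC" "c \<in> LC (ckey d l m) n" "z \<in> adm Q (d + 1)" for LC l m n c z
    using that(1,2)
  proof (induction arbitrary: l m n c rule: reach.induct)
    case reach_init
    then have "c \<in> A" by (auto simp: A_def)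
    then have "\<bar>b c\<bar> \<le> (\<Sum>c\<in>A. \<bar>b c\<bar>)" using \<open>finite A\<close> by (intro member_le_sum) auto
    then show ?case using b[OF that(3), of c] by (simp add: C_def)
  next
    case (reach_cut LC d' l' m' z' \<theta> \<sigma> l0)
    show ?case
    proof (cases "c \<in> LC (ckey d l m) n")
      case True
      then show ?thesis by (rule reach_cut.IH)
    next
      case False
      then have c: "c = (\<theta>, \<sigma>, z')" and key: "ckey (d' - 1) l0 l' = ckey d l m"
        using reach_cut.prems by (auto split: if_splits)
      have d': "d' = d + 1" using key reach_cut.hyps(2) by (auto simp: ckey_def)
      have "z \<in> vsp ?k" using adm_vsp[OF dn(3) that(3)] by simp
      \<comment> \<open>The subgradient inequality is read against the collection \<open>LC\<close>
        from which the cut was computed, itself reachable.\<close>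
      then have "ereal \<theta> + ereal (ip ?k \<sigma> (\<lambda>i. z i - z' i)) \<le> LPval Q x LC (d + 1) l' m' z"
        using reach_cut.hyps(3,4) unfolding is_subgrad_def d' by auto
      also have "\<dots> \<le> ereal B" using B[OF reach_cut.hyps(1)] feas_nonempty[OF dn(3) that(3)] by blast
      finally show ?thesis by (simp add: c C_def)
    qed
  qed
  have "LPval Q x LC d l m z \<le> ereal (S + \<bar>C\<bar>)" if r: "reach LC0 LC" and "feas Q x d l m z \<noteq> {}" for LC l m z
  proof -
    obtain y where y: "y \<in> feas Q x d l m z" using \<open>feas Q x d l m z \<noteq> {}\<close> by blast
    have "y \<omega> \<in> adm Q (d + 1)" for \<omega> using adm_Suc[OF feas_Yset[OF y]] by simp
    then have "(y, \<lambda>_ _. C) \<in> LPfeas Q x LC d l m z" using y cuts[OF r] by (fastforce simp: LPfeas_def)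
    from LPval_le[OF this] show ?thesis using S[OF feas_Yset[OF y], of m C]
      by (auto intro: order_trans)
  qed
  then show ?case by blast
qed

text \<open>From an admissible \<open>z\<close>, steps of length \<open>r\<close> in both directions
  of each coordinate stay feasible. The value there is at most \<open>B\<close> and at
  \<open>z\<close> at least \<open>L\<close>, so the subgradient inequality bounds each component by
  \<open>(B - L) / r\<close>, uniformly in the cuts and in \<open>z\<close>.\<close>

lemma cut_slopes_bounded:
  assumes fin: "\<forall>\<kappa> n. finite (LC0 \<kappa> n)" and d: "d \<in> {2..nst Q}"
  shows "\<exists>C. \<forall>LC z \<sigma>. reach LC0 LC \<longrightarrow> z \<in> adm Q d \<longrightarrow> ereal L \<le> LPval Q x LC d l m z \<longrightarrow>
     is_subgrad (dimy Q (d - 1)) (LPval Q x LC d l m) z \<sigma> \<longrightarrow> (\<forall>i<dimy Q (d - 1). \<bar>\<sigma> i\<bar> \<le> C)"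
proof -
  let ?k = "dimy Q (d - 1)"
  obtain B where B: "\<And>LC z. reach LC0 LC \<Longrightarrow> feas Q x d l m z \<noteq> {} \<Longrightarrow> LPval Q x LC d l m z \<le> ereal B"
    using LPval_bounded_above[OF assms] by blast
  obtain r where r: "r > 0" "\<And>z i. z \<in> adm Q d \<Longrightarrow> i < ?k \<Longrightarrow> feas Q x d l m (z(i := z i + r)) \<noteq> {}"
    "\<And>z i. z \<in> adm Q d \<Longrightarrow> i < ?k \<Longrightarrow> feas Q x d l m (z(i := z i - r)) \<noteq> {}"
    using feas_margin[OF d, of l m] by blast
  have "\<bar>\<sigma> i\<bar> \<le> (B - L) / r"
    if R: "reach LC0 LC" and z: "z \<in> adm Q d" and L: "ereal L \<le> LPval Q x LC d l m z"
      and sg: "is_subgrad ?k (LPval Q x LC d l m) z \<sigma>" and i: "i < ?k" for LC z \<sigma> i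
  proof -
    have step: "\<sigma> i * s \<le> B - L" if "feas Q x d l m (z(i := z i + s)) \<noteq> {}" for s
    proof -
      let ?z = "z(i := z i + s)"
      have "?z \<in> vsp ?k" using adm_vsp[OF d z] i by (auto simp: vsp_def)
      then have "LPval Q x LC d l m z + ereal (ip ?k \<sigma> (\<lambda>j. ?z j - z j)) \<le> LPval Q x LC d l m ?z"
        using sg unfolding is_subgrad_def by blast
      moreover have "ip ?k \<sigma> (\<lambda>j. ?z j - z j) = \<sigma> i * s"
        unfolding ip_diff_right ip_fun_upd[OF i] by simp
      ultimately have "ereal L + ereal (\<sigma> i * s) \<le> ereal B"
        using L B[OF R that] add_right_mono order_trans by metis
      then show ?thesis by simp
    qed
    show ?thesis using step[of r] step[of "- r"] r(1) r(2,3)[OF z i]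
      by (simp add: field_simps abs_le_iff)
  qed
  then show ?thesis by blast
qed

text \<open>Placing all weight on one stored point and letting \<open>\<gamma>\<close> bridge the
  distance to \<open>y \<omega>\<close> is feasible. Done for a single pair \<open>\<omega>\<close>,
  \<open>n\<close> of positive probability, this would improve the objective if
  \<open>th \<omega> n\<close> exceeded the claimed bound.\<close>

lemma UP_fixed_le:
  assumes opt: "UPopt_fixed Q x My UC d l m z y th \<gamma> \<mu>" and d: "d \<in> {1..<nst Q}"
    and pos: "ptr Q (d + 1) m n > 0" and mem: "(\<theta>, s) \<in> UC (ckey d l m) n"
    and fin: "finite (UC (ckey d l m) n)" and s: "s \<in> vsp (dimy Q d)"
  shows "th \<omega> n \<le> \<theta> + My * norm1 (dimy Q d) (\<lambda>i. s i - y \<omega> i)"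
proof -
  let ?b = "\<theta> + My * norm1 (dimy Q d) (\<lambda>i. s i - y \<omega> i)"
  let ?\<mu> = "\<mu>(\<omega> := (\<mu> \<omega>)(n := (\<lambda>p. if p = (\<theta>, s) then 1 else 0)))"
  let ?\<gamma> = "\<gamma>(\<omega> := (\<gamma> \<omega>)(n := (\<lambda>i. s i - y \<omega> i)))"
  let ?th = "th(\<omega> := (th \<omega>)(n := ?b))"
  have feas: "(y, th, \<gamma>, \<mu>) \<in> UPfeas Q x My UC d l m z" using opt by (simp add: UPopt_fixed_def)
  then have y: "y \<omega> \<in> vsp (dimy Q d)" using d by (auto simp: UPfeas_def feas_def intro!: Yset_vsp)
  have delta: "(\<Sum>p\<in>UC (ckey d l m) n. (if p = (\<theta>, s) then 1 else 0) * h p) = h (\<theta>, s)" for h :: "real \<times> (nat \<Rightarrow> real) \<Rightarrow> real"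
  proof -
    have "(\<Sum>p\<in>UC (ckey d l m) n. (if p = (\<theta>, s) then 1 else 0) * h p) = (\<Sum>p\<in>UC (ckey d l m) n. if p = (\<theta>, s) then h p else 0)"
      by (intro sum.cong) auto
    then show ?thesis using fin mem by simp
  qed
  have "(\<Sum>p\<in>UC (ckey d l m) n. (if p = (\<theta>, s) then 1 else 0)) = (1::real)" using fin mem by simp
  moreover have "(\<lambda>i. s i - y \<omega> i) \<in> vsp (dimy Q d)" using s y by (simp add: vsp_def)
  ultimately have "(y, ?th, ?\<gamma>, ?\<mu>) \<in> UPfeas Q x My UC d l m z"
    using feas unfolding UPfeas_def by (auto simp: delta)
  then have "aobj Q d m y th \<le> aobj Q d m y ?th" using opt by (auto simp: UPopt_fixed_def)
  then have "0 \<le> pw TYPE('w) * ptr Q (d + 1) m n * (?b - th \<omega> n)"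
    using aobj_fun_upd[of d m y th \<omega> n ?b] d by simp
  moreover have "pw TYPE('w) * ptr Q (d + 1) m n > 0" using pos by (simp add: pw_def)
  ultimately show ?thesis by (simp add: zero_le_mult_iff)
qed

end

section \<open>Iterations\<close>

text \<open>The drop of the threshold from stage to stage is the amount by which a refinement
  improves on the gap that triggered it.\<close>

lemma thr_Suc:
  assumes "2 \<le> d" "d < nst Q"
  shows "thr Q \<delta> (d + 1) = thr Q \<delta> d - \<delta> / real (nst Q - 1)"
proof -
  have "real (nst Q - d + 1) = real (nst Q - (d + 1) + 1) + 1" using assms by simp
  then show ?thesis by (simp add: thr_def distrib_left add_divide_distrib)
qed

text \<open>Convergence in the product topology is coordinatewise, and the norm sums finitely many
  coordinates; hence consecutive members of a convergent subsequence come arbitrarily close.\<close>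

lemma compact_ex_norm1_close:
  fixes z :: "nat \<Rightarrow> nat \<Rightarrow> real"
  assumes K: "compact K" "\<And>j. z j \<in> K" and "\<epsilon> > 0"
  shows "\<exists>i j. i < j \<and> norm1 k (\<lambda>n. z i n - z j n) < \<epsilon>"
proof -
  obtain l r where r: "strict_mono r" "(z \<circ> r) \<longlonglongrightarrow> l"
    using K unfolding compact_def by blast
  have lim: "(\<lambda>j. z (r j) n) \<longlonglongrightarrow> l n" for n
  proof -
    have "isCont (\<lambda>f :: nat \<Rightarrow> real. f n) l"
      using continuous_on_product_coordinates[of n] continuous_on_eq_continuous_at[OF open_UNIV] by blast
    from isCont_tendsto_compose[OF this r(2)] show ?thesis by simp
  qed
  have "(\<lambda>j. norm1 k (\<lambda>n. z (r j) n - z (r (Suc j)) n)) \<longlonglongrightarrow> norm1 k (\<lambda>n. l n - l n)"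
    unfolding norm1_def by (intro tendsto_intros lim LIMSEQ_Suc[OF lim])
  then have "(\<lambda>j. norm1 k (\<lambda>n. z (r j) n - z (r (Suc j)) n)) \<longlonglongrightarrow> 0" by (simp add: norm1_def)
  from order_tendstoD(2)[OF this \<open>\<epsilon> > 0\<close>]
  obtain j where "norm1 k (\<lambda>n. z (r j) n - z (r (Suc j)) n) < \<epsilon>"
    unfolding eventually_sequentially by blast
  then show ?thesis using strict_monoD[OF r(1), of j "Suc j"] by blast
qed

context multistage
begin

text \<open>The iteration leading from \<open>LC, UC\<close> to \<open>LC', UC'\<close> stops its forward pass at stage \<open>d\<close> with states
  \<open>l0, l, m\<close> at stages \<open>d - 2, d - 1, d\<close> and argument \<open>z\<close>; \<open>tl\<close> and \<open>tu\<close> are the approximate values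
  found there in the forward pass.\<close>

definition refines_at :: "real \<Rightarrow> 's lcuts \<Rightarrow> 's ucuts \<Rightarrow> 's lcuts \<Rightarrow> 's ucuts \<Rightarrow> nat \<Rightarrow> 's \<Rightarrow> 's \<Rightarrow> 's \<Rightarrow> (nat \<Rightarrow> real) \<Rightarrow> bool"
  where "refines_at \<delta> LC UC LC' UC' d l0 l m z \<longleftrightarrow> d \<in> {2..nst Q} \<and> z \<in> adm Q d \<and>
    (\<exists>tl tu. tu - tl > thr Q \<delta> d
      \<and> (\<forall>\<theta> \<sigma> s. (\<theta>, \<sigma>, s) \<in> LC (ckey (d - 1) l0 l) m \<longrightarrow> \<theta> + ip (dimy Q (d - 1)) \<sigma> (\<lambda>i. z i - s i) \<le> tl)
      \<and> (\<forall>\<theta> s. (\<theta>, s) \<in> UC (ckey (d - 1) l0 l) m \<longrightarrow> s \<in> vsp (dimy Q (d - 1)) \<longrightarrow>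
            tu \<le> \<theta> + My * norm1 (dimy Q (d - 1)) (\<lambda>i. s i - z i))) \<and>
    (\<exists>L. \<forall>z'. ereal L \<le> LPval Q x LC d l m z') \<and>
    (\<exists>\<theta>l \<sigma> \<theta>u. \<theta>u - \<theta>l \<le> thr Q \<delta> d - \<delta> / real (nst Q - 1)
      \<and> is_subgrad (dimy Q (d - 1)) (LPval Q x LC d l m) z \<sigma>
      \<and> (\<theta>l, \<sigma>, z) \<in> LC' (ckey (d - 1) l0 l) m \<and> (\<theta>u, z) \<in> UC' (ckey (d - 1) l0 l) m)"

text \<open>The body of \<open>alg_iter\<close> with its nondeterministic choices exposed as
  parameters, so that its clauses can be taken apart one by one.\<close>

definition iter_trace :: "real \<Rightarrow> 's lcuts \<Rightarrow> 's ucuts \<Rightarrow> ('s \<Rightarrow> ereal) \<Rightarrow> ('s \<Rightarrow> ereal) \<Rightarrow>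
    (nat \<Rightarrow> 's) \<Rightarrow> (nat \<Rightarrow> 'w) \<Rightarrow> (nat \<Rightarrow> 'w \<Rightarrow> nat \<Rightarrow> real) \<Rightarrow> (nat \<Rightarrow> 'w \<Rightarrow> 's \<Rightarrow> real) \<Rightarrow>
    (nat \<Rightarrow> 'w \<Rightarrow> 's \<Rightarrow> real) \<Rightarrow> nat \<Rightarrow> (nat \<Rightarrow> 's lcuts) \<Rightarrow> (nat \<Rightarrow> 's ucuts) \<Rightarrow> bool"
  where "iter_trace \<delta> LC UC lo up m om y thl thu dh LCs UCs \<longleftrightarrow>
    (p1 Q (m 1) > 0)
  \<and> (\<forall>m'. p1 Q m' > 0 \<longrightarrow> up m' - lo m' \<le> up (m 1) - lo (m 1))
  \<and> (LPopt Q x LC 1 (m 0) (m 1) (y 0 (om 0)) (y 1) (thl 2))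
  \<and> (\<exists>\<gamma> \<mu>. UPopt_fixed Q x My UC 1 (m 0) (m 1) (y 0 (om 0)) (y 1) (thu 2) \<gamma> \<mu>)
  \<and> (1 \<le> dh)
  \<and> (dh \<le> nst Q)
  \<and> (\<forall>d\<in>{2..dh}.
        ptr Q d (m (d - 1)) (m d) > 0
      \<and> (\<forall>\<omega> n. ptr Q d (m (d - 1)) n > 0 \<longrightarrow>
            thu d \<omega> n - thl d \<omega> n \<le> thu d (om (d - 1)) (m d) - thl d (om (d - 1)) (m d))
      \<and> thu d (om (d - 1)) (m d) - thl d (om (d - 1)) (m d) > thr Q \<delta> d
      \<and> LPopt Q x LC d (m (d - 1)) (m d) (y (d - 1) (om (d - 1))) (y d) (thl (d + 1))
      \<and> (d < nst Q \<longrightarrow> (\<exists>\<gamma> \<mu>. UPopt_fixed Q x My UC d (m (d - 1)) (m d) (y (d - 1) (om (d - 1)))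
                              (y d) (thu (d + 1)) \<gamma> \<mu>)))
  \<and> (dh < nst Q \<longrightarrow> (\<forall>\<omega> n. ptr Q (dh + 1) (m dh) n > 0 \<longrightarrow>
            thu (dh + 1) \<omega> n - thl (dh + 1) \<omega> n \<le> thr Q \<delta> (dh + 1)))
  \<and> (LCs (dh + 1) = LC)
  \<and> (UCs (dh + 1) = UC)
  \<and> (\<forall>d\<in>{2..dh}. \<exists>\<theta>l \<sigma> \<theta>u.
        LPval Q x (LCs (d + 1)) d (m (d - 1)) (m d) (y (d - 1) (om (d - 1))) = ereal \<theta>l
      \<and> is_subgrad (dimy Q (d - 1)) (LPval Q x (LCs (d + 1)) d (m (d - 1)) (m d))
                   (y (d - 1) (om (d - 1))) \<sigma>
      \<and> UPval Q x My (UCs (d + 1)) d (m (d - 1)) (m d) (y (d - 1) (om (d - 1))) = ereal \<theta>u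
      \<and> LCs d = (LCs (d + 1))(ckey (d - 1) (m (d - 2)) (m (d - 1)) :=
                   (LCs (d + 1) (ckey (d - 1) (m (d - 2)) (m (d - 1))))(m d :=
                      insert (\<theta>l, \<sigma>, y (d - 1) (om (d - 1)))
                        (LCs (d + 1) (ckey (d - 1) (m (d - 2)) (m (d - 1))) (m d))))
      \<and> UCs d = (UCs (d + 1))(ckey (d - 1) (m (d - 2)) (m (d - 1)) :=
                   (UCs (d + 1) (ckey (d - 1) (m (d - 2)) (m (d - 1))))(m d :=
                      insert (\<theta>u, y (d - 1) (om (d - 1)))
                        (UCs (d + 1) (ckey (d - 1) (m (d - 2)) (m (d - 1))) (m d)))))"

lemma alg_iter_trace:
  "alg_iter Q x My \<delta> (LC, UC, lo, up) st' \<longleftrightarrow> (\<exists>m om y thl thu dh LCs UCs.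
     iter_trace \<delta> LC UC lo up m om y thl thu dh LCs UCs \<and>
     st' = (LCs 2, UCs 2,
            lo(m 1 := LPval Q x (LCs 2) 1 (m 0) (m 1) (y 0 (om 0))),
            up(m 1 := UPval Q x My (UCs 2) 1 (m 0) (m 1) (y 0 (om 0)))))"
  unfolding alg_iter_def iter_trace_def prod.case conj_assoc by (rule refl)

text \<open>Apart from the invariants, everything depends on where the forward pass stops: at a
  stage \<open>dh\<close> of at least 2 it yields a refinement there, at stage 1 it closes the gap
  of the selected first-stage state.\<close>

lemma alg_iter_cases:
  assumes iter: "alg_iter Q x My \<delta> (LC, UC, lo, up) (LC', UC', lo', up')"
    and finLC0: "\<forall>\<kappa> n. finite (LC0 \<kappa> n)" and reach: "reach LC0 LC"
    and finUC: "\<And>\<kappa> n. finite (UC \<kappa> n)" and lo: "\<And>m. lo m \<noteq> \<infinity>"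
  shows "reach LC0 LC' \<and> (\<forall>\<kappa> n. LC \<kappa> n \<subseteq> LC' \<kappa> n \<and> UC \<kappa> n \<subseteq> UC' \<kappa> n \<and> finite (UC' \<kappa> n)) \<and> (\<forall>m. lo' m \<noteq> \<infinity>) \<and>
    ((\<exists>d l0 l m z. refines_at \<delta> LC UC LC' UC' d l0 l m z) \<or>
     (\<exists>m a b. p1 Q m > 0 \<and> (\<forall>m'. p1 Q m' > 0 \<longrightarrow> up m' - lo m' \<le> up m - lo m) \<and>
        lo' = lo(m := ereal a) \<and> up' = up(m := b) \<and> b \<le> ereal (a + \<delta>)))"
proof -
  obtain m om y thl thu dh LCs UCs where tr: "iter_trace \<delta> LC UC lo up m om y thl thu dh LCs UCs"
    and st': "LC' = LCs 2" "UC' = UCs 2"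
      "lo' = lo(m 1 := LPval Q x (LCs 2) 1 (m 0) (m 1) (y 0 (om 0)))"
      "up' = up(m 1 := UPval Q x My (UCs 2) 1 (m 0) (m 1) (y 0 (om 0)))"
    using iter unfolding alg_iter_trace prod.inject by blast
  note t = tr[unfolded iter_trace_def]
  note p1 = conjunct1[OF t] and t = conjunct2[OF t]
  note argmax = conjunct1[OF t] and t = conjunct2[OF t]
  note LP1 = conjunct1[OF t] and t = conjunct2[OF t]
  note UP1 = conjunct1[OF t] and t = conjunct2[OF t]
  note dh1 = conjunct1[OF t] and t = conjunct2[OF t]
  note dh2 = conjunct1[OF t] and t = conjunct2[OF t]
  note fwd = conjunct1[OF t] and t = conjunct2[OF t]
  note stop = conjunct1[OF t] and t = conjunct2[OF t]
  note topL = conjunct1[OF t] and t = conjunct2[OF t]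
  note topU = conjunct1[OF t] and t = conjunct2[OF t]
  note bwd = t
  note dh = dh1 dh2 and top = topL topU
  have iteration: "(reach LC0 (LCs (d + 1)) \<longrightarrow> reach LC0 (LCs d)) \<and> (\<forall>\<kappa> n. LCs (d + 1) \<kappa> n \<subseteq> LCs d \<kappa> n \<and>
      UCs (d + 1) \<kappa> n \<subseteq> UCs d \<kappa> n \<and> (finite (UCs (d + 1) \<kappa> n) \<longrightarrow> finite (UCs d \<kappa> n)))"
    if d: "d \<in> {2..dh}" for d
  proof -
    obtain \<theta>l \<sigma> \<theta>u where
      b: "LPval Q x (LCs (d + 1)) d (m (d - 1)) (m d) (y (d - 1) (om (d - 1))) = ereal \<theta>l"
      "is_subgrad (dimy Q (d - 1)) (LPval Q x (LCs (d + 1)) d (m (d - 1)) (m d)) (y (d - 1) (om (d - 1))) \<sigma>"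
      and L: "LCs d = (LCs (d + 1))(ckey (d - 1) (m (d - 2)) (m (d - 1)) :=
                   (LCs (d + 1) (ckey (d - 1) (m (d - 2)) (m (d - 1))))(m d :=
                      insert (\<theta>l, \<sigma>, y (d - 1) (om (d - 1)))
                        (LCs (d + 1) (ckey (d - 1) (m (d - 2)) (m (d - 1))) (m d))))"
      and U: "UCs d = (UCs (d + 1))(ckey (d - 1) (m (d - 2)) (m (d - 1)) :=
                   (UCs (d + 1) (ckey (d - 1) (m (d - 2)) (m (d - 1))))(m d :=
                      insert (\<theta>u, y (d - 1) (om (d - 1)))
                        (UCs (d + 1) (ckey (d - 1) (m (d - 2)) (m (d - 1))) (m d))))"
      using bwd[rule_format, OF d] by blast
    have "d \<in> {2..nst Q}" using d dh by simp
    then have "reach LC0 (LCs (d + 1)) \<longrightarrow> reach LC0 (LCs d)"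
      unfolding L by (intro impI reach_cut b)
    moreover have "LCs (d + 1) \<kappa> n \<subseteq> LCs d \<kappa> n \<and> UCs (d + 1) \<kappa> n \<subseteq> UCs d \<kappa> n \<and>
       (finite (UCs (d + 1) \<kappa> n) \<longrightarrow> finite (UCs d \<kappa> n))" for \<kappa> n
      unfolding L U by auto
    ultimately show ?thesis by blast
  qed
  \<comment> \<open>Induction downwards from \<open>dh + 1\<close>, in the order in which the
    backward pass treats the stages.\<close>
  have above: "reach LC0 (LCs d) \<and> (\<forall>\<kappa> n. LC \<kappa> n \<subseteq> LCs d \<kappa> n \<and> UC \<kappa> n \<subseteq> UCs d \<kappa> n \<and> finite (UCs d \<kappa> n))"
    if "d \<le> dh + 1" "2 \<le> d" for d
    using that
  proof (induction rule: inc_induct)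
    case base
    then show ?case using reach finUC top by simp
  next
    case (step d)
    then have d: "d \<in> {2..dh}" "2 \<le> Suc d" by auto
    show ?case using step.IH[OF d(2)] iteration[OF d(1)] unfolding Suc_eq_plus1 by blast
  qed
  have below: "\<forall>\<kappa> n. LCs d \<kappa> n \<subseteq> LCs 2 \<kappa> n \<and> UCs d \<kappa> n \<subseteq> UCs 2 \<kappa> n" if "2 \<le> d" "d \<le> dh + 1" for d
    using that
  proof (induction rule: dec_induct)
    case (step d)
    then have d: "d \<in> {2..dh}" "d \<le> dh + 1" by auto
    show ?case using step.IH[OF d(2)] iteration[OF d(1)] unfolding Suc_eq_plus1 by blast
  qed simp
  have invariants: "reach LC0 LC'" "\<forall>\<kappa> n. LC \<kappa> n \<subseteq> LC' \<kappa> n \<and> UC \<kappa> n \<subseteq> UC' \<kappa> n \<and> finite (UC' \<kappa> n)"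
    using above[of 2] dh unfolding st' by auto
  have "feas Q x 1 (m 0) (m 1) (y 0 (om 0)) \<noteq> {}"
    using recourse by (simp add: rel_complete_recourse_def)
  then have "LPval Q x LC' 1 (m 0) (m 1) (y 0 (om 0)) < \<infinity>"
    using reach_finite[OF invariants(1) finLC0] by (rule LPval_less_top)
  then have lo': "lo' n \<noteq> \<infinity>" for n using lo unfolding st' by auto
  have "(\<exists>d l0 l m z. refines_at \<delta> LC UC LC' UC' d l0 l m z) \<or>
     (\<exists>m a b. p1 Q m > 0 \<and> (\<forall>m'. p1 Q m' > 0 \<longrightarrow> up m' - lo m' \<le> up m - lo m) \<and>
        lo' = lo(m := ereal a) \<and> up' = up(m := b) \<and> b \<le> ereal (a + \<delta>))"
  proof (cases "dh = 1")
    case True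
    have n: "1 \<in> {1..<nst Q}" using nst_ge_2 by simp
    \<comment> \<open>Here \<open>dh + 1 = 2\<close>, so the backward pass is empty and the final
      collections are those used by the forward pass.\<close>
    have LU: "LCs 2 = LC" "UCs 2 = UC" using top unfolding True by (simp_all add: numeral_2_eq_2)
    let ?a = "aobj Q 1 (m 1) (y 1) (thl 2)"
    obtain \<gamma> \<mu> where "(y 1, thu 2, \<gamma>, \<mu>) \<in> UPfeas Q x My UC 1 (m 0) (m 1) (y 0 (om 0))"
      using UP1 unfolding UPopt_fixed_def by blast
    from UPval_le[OF this]
    have "UPval Q x My UC 1 (m 0) (m 1) (y 0 (om 0)) \<le> ereal (aobj Q 1 (m 1) (y 1) (thu 2))" .
    also have "aobj Q 1 (m 1) (y 1) (thu 2) \<le> ?a + \<delta>"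
    proof (rule aobj_mono[OF n])
      fix \<omega> k assume "ptr Q (1 + 1) (m 1) k > 0"
      then have "thu 2 \<omega> k - thl 2 \<omega> k \<le> thr Q \<delta> 2"
        using stop n unfolding True one_add_one by simp
      moreover have "thr Q \<delta> 2 = \<delta>"
      proof -
        have "nst Q - 2 + 1 = nst Q - 1" using nst_ge_2 by simp
        then show ?thesis using nst_ge_2 by (simp add: thr_def)
      qed
      ultimately show "thu 2 \<omega> k \<le> thl 2 \<omega> k + \<delta>" by simp
    qed
    finally have "UPval Q x My UC 1 (m 0) (m 1) (y 0 (om 0)) \<le> ereal (?a + \<delta>)" by simp
    then show ?thesis using p1 argmax unfolding st' LU LPval_eq[OF LP1] by blast
  next
    case False
    let ?z = "y (dh - 1) (om (dh - 1))" and ?k = "dimy Q (dh - 1)"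
    let ?\<kappa> = "ckey (dh - 1) (m (dh - 2)) (m (dh - 1))"
    have d: "dh \<in> {2..dh}" "dh \<in> {2..nst Q}" "dh - 1 \<in> {1..<nst Q}" "dh - 1 + 1 = dh" "dh \<in> {1..nst Q}"
      using False dh by auto
    note f = fwd[rule_format, OF d(1)]
    \<comment> \<open>The problems that produced the gap seen at \<open>dh\<close>. Stage 1 is
      separate because its solutions are not among those indexed from 2 on; then
      \<open>dh - 2\<close> is 0 and \<open>z'\<close> is the dummy argument.\<close>
    have prev: "\<exists>z'. LPopt Q x LC (dh - 1) (m (dh - 2)) (m (dh - 1)) z' (y (dh - 1)) (thl dh) \<and>
       (\<exists>\<gamma> \<mu>. UPopt_fixed Q x My UC (dh - 1) (m (dh - 2)) (m (dh - 1)) z' (y (dh - 1)) (thu dh) \<gamma> \<mu>)"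
    proof (cases "dh = 2")
      case True
      then show ?thesis using LP1 UP1 by auto
    next
      case False
      then have d': "dh - 1 \<in> {2..dh}" using d(1) by auto
      have e: "dh - 1 - 1 = dh - 2" by simp
      have "dh - 1 < nst Q" using d(3) by simp
      then show ?thesis using fwd[rule_format, OF d'] unfolding e d(4) by blast
    qed
    then obtain z' \<gamma> \<mu> where LPp: "LPopt Q x LC (dh - 1) (m (dh - 2)) (m (dh - 1)) z' (y (dh - 1)) (thl dh)"
      and UPp: "UPopt_fixed Q x My UC (dh - 1) (m (dh - 2)) (m (dh - 1)) z' (y (dh - 1)) (thu dh) \<gamma> \<mu>"
      by blast
    have LPpf: "(y (dh - 1), thl dh) \<in> LPfeas Q x LC (dh - 1) (m (dh - 2)) (m (dh - 1)) z'"
      using LPp by (simp add: LPopt_def)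
    have z: "?z \<in> adm Q dh" using adm_Suc[OF LPfeas_Yset[OF LPpf]] d(4) by simp
    have opt: "LPopt Q x LC dh (m (dh - 1)) (m dh) ?z (y dh) (thl (dh + 1))" using f by blast
    have lower: "\<theta> + ip ?k \<sigma> (\<lambda>i. ?z i - s i) \<le> thl dh (om (dh - 1)) (m dh)"
      if "(\<theta>, \<sigma>, s) \<in> LC ?\<kappa> (m dh)" for \<theta> \<sigma> s
      using LPfeas_cut[OF LPpf _ that] d(3) by simp
    have upper: "thu dh (om (dh - 1)) (m dh) \<le> \<theta> + My * norm1 ?k (\<lambda>i. s i - ?z i)"
      if "(\<theta>, s) \<in> UC ?\<kappa> (m dh)" "s \<in> vsp ?k" for \<theta> s
      using UP_fixed_le[OF UPp d(3) _ that(1) finUC that(2)] f unfolding d(4) by blast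
    \<comment> \<open>Stage \<open>dh\<close> comes first in the backward pass and still sees the
      collections of the forward pass, so \<open>\<theta>l\<close> is the forward optimal
      value.\<close>
    obtain \<theta>l \<sigma> \<theta>u where
      b: "LPval Q x LC dh (m (dh - 1)) (m dh) ?z = ereal \<theta>l"
      "is_subgrad ?k (LPval Q x LC dh (m (dh - 1)) (m dh)) ?z \<sigma>"
      "UPval Q x My UC dh (m (dh - 1)) (m dh) ?z = ereal \<theta>u"
      and L: "LCs dh = LC(?\<kappa> := (LC ?\<kappa>)(m dh := insert (\<theta>l, \<sigma>, ?z) (LC ?\<kappa> (m dh))))"
      and U: "UCs dh = UC(?\<kappa> := (UC ?\<kappa>)(m dh := insert (\<theta>u, ?z) (UC ?\<kappa> (m dh))))"
      using bwd[rule_format, OF d(1)] unfolding top by blast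
    have \<theta>l: "\<theta>l = aobj Q dh (m dh) (y dh) (thl (dh + 1))" using LPval_eq[OF opt] b(1) by simp
    have gap: "\<theta>u - \<theta>l \<le> thr Q \<delta> dh - \<delta> / real (nst Q - 1)"
    proof (cases "dh < nst Q")
      case True
      then obtain \<gamma>' \<mu>' where "(y dh, thu (dh + 1), \<gamma>', \<mu>') \<in> UPfeas Q x My UC dh (m (dh - 1)) (m dh) ?z"
        using f unfolding UPopt_fixed_def by blast
      from UPval_le[OF this] have "\<theta>u \<le> aobj Q dh (m dh) (y dh) (thu (dh + 1))" using b(3) by simp
      also have "\<dots> \<le> \<theta>l + thr Q \<delta> (dh + 1)"
        unfolding \<theta>l
      proof (rule aobj_mono)
        show "dh \<in> {1..<nst Q}" using True dh by simp
        show "thu (dh + 1) \<omega> n \<le> thl (dh + 1) \<omega> n + thr Q \<delta> (dh + 1)" if "ptr Q (dh + 1) (m dh) n > 0" for \<omega> n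
        proof -
          have "thu (dh + 1) \<omega> n - thl (dh + 1) \<omega> n \<le> thr Q \<delta> (dh + 1)" using stop True that by blast
          then show ?thesis by simp
        qed
      qed
      also have "thr Q \<delta> (dh + 1) = thr Q \<delta> dh - \<delta> / real (nst Q - 1)"
        using True d by (intro thr_Suc) auto
      finally show ?thesis by simp
    next
      \<comment> \<open>At the last stage the lower and upper problems coincide and the claimed
        bound is 0. The values of \<open>\<gamma>\<close> and \<open>\<mu>\<close> are unconstrained
        there, hence \<open>undefined\<close>.\<close>
      case False
      then have e: "dh = nst Q" using dh by simp
      have "y dh \<in> feas Q x dh (m (dh - 1)) (m dh) ?z" using opt by (auto simp: LPopt_def LPfeas_def)
      then have "(y dh, thl (dh + 1), undefined, undefined) \<in> UPfeas Q x My UC dh (m (dh - 1)) (m dh) ?z"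
        using e by (simp add: UPfeas_def)
      from UPval_le[OF this] have "\<theta>u \<le> \<theta>l" using b(3) \<theta>l by simp
      then show ?thesis by (simp add: e thr_def)
    qed
    have "(\<theta>l, \<sigma>, ?z) \<in> LCs dh ?\<kappa> (m dh)" "(\<theta>u, ?z) \<in> UCs dh ?\<kappa> (m dh)"
      unfolding L U by simp_all
    \<comment> \<open>The remaining backward steps only add elements, so both new ones
      survive.\<close>
    then have "(\<theta>l, \<sigma>, ?z) \<in> LC' ?\<kappa> (m dh)" "(\<theta>u, ?z) \<in> UC' ?\<kappa> (m dh)"
      using below[of dh] d(1) unfolding st' atLeastAtMost_iff by (meson le_add1 subsetD)+
    then have new: "\<exists>\<theta>l \<sigma> \<theta>u. \<theta>u - \<theta>l \<le> thr Q \<delta> dh - \<delta> / real (nst Q - 1)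
      \<and> is_subgrad ?k (LPval Q x LC dh (m (dh - 1)) (m dh)) ?z \<sigma>
      \<and> (\<theta>l, \<sigma>, ?z) \<in> LC' ?\<kappa> (m dh) \<and> (\<theta>u, ?z) \<in> UC' ?\<kappa> (m dh)"
      using gap b(2) by blast
    have "thu dh (om (dh - 1)) (m dh) - thl dh (om (dh - 1)) (m dh) > thr Q \<delta> dh" using f by blast
    then have "refines_at \<delta> LC UC LC' UC' dh (m (dh - 2)) (m (dh - 1)) (m dh) ?z"
      unfolding refines_at_def
      by (intro conjI d(2) z LPval_bounded_below[OF d(5) opt] new
            exI[of _ "thl dh (om (dh - 1)) (m dh)"] exI[of _ "thu dh (om (dh - 1)) (m dh)"])
         (use lower upper in blast)+
    then show ?thesis by blast
  qed
  then show ?thesis using invariants lo' by blast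
qed

text \<open>The elements stored at \<open>z\<close> are still present when \<open>z'\<close> is
  visited. They bound the gap at \<open>z'\<close> by the small gap at \<open>z\<close> plus the
  Lipschitz terms \<open>C\<close> and \<open>My\<close> times the distance, yet that gap exceeds
  the threshold.\<close>

lemma refinements_separated:
  assumes 1: "refines_at \<delta> LC UC LC1 UC1 d l0 l m z" and 2: "refines_at \<delta> LC2 UC2 LC3 UC3 d l0 l m z'"
    and mono: "\<And>\<kappa> n. LC1 \<kappa> n \<subseteq> LC2 \<kappa> n" "\<And>\<kappa> n. UC1 \<kappa> n \<subseteq> UC2 \<kappa> n"
    and C: "\<And>\<sigma>. is_subgrad (dimy Q (d - 1)) (LPval Q x LC d l m) z \<sigma> \<Longrightarrow> \<forall>i<dimy Q (d - 1). \<bar>\<sigma> i\<bar> \<le> C"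
  shows "\<delta> / real (nst Q - 1) < (C + My) * norm1 (dimy Q (d - 1)) (\<lambda>i. z i - z' i)"
proof -
  let ?k = "dimy Q (d - 1)" and ?\<kappa> = "ckey (d - 1) l0 l"
  obtain \<theta>l \<sigma> \<theta>u where a: "\<theta>u - \<theta>l \<le> thr Q \<delta> d - \<delta> / real (nst Q - 1)"
    "is_subgrad ?k (LPval Q x LC d l m) z \<sigma>" "(\<theta>l, \<sigma>, z) \<in> LC1 ?\<kappa> m" "(\<theta>u, z) \<in> UC1 ?\<kappa> m"
    using 1 unfolding refines_at_def by blast
  have z: "z \<in> vsp ?k" using 1 unfolding refines_at_def by (intro adm_vsp) blast+
  obtain tl tu where b: "tu - tl > thr Q \<delta> d"
    "\<And>\<theta> \<sigma> s. (\<theta>, \<sigma>, s) \<in> LC2 ?\<kappa> m \<Longrightarrow> \<theta> + ip ?k \<sigma> (\<lambda>i. z' i - s i) \<le> tl"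
    "\<And>\<theta> s. (\<theta>, s) \<in> UC2 ?\<kappa> m \<Longrightarrow> s \<in> vsp ?k \<Longrightarrow> tu \<le> \<theta> + My * norm1 ?k (\<lambda>i. s i - z' i)"
    using 2 unfolding refines_at_def by blast
  have "\<theta>l + ip ?k \<sigma> (\<lambda>i. z' i - z i) \<le> tl" using b(2) a(3) mono by blast
  moreover have "tu \<le> \<theta>u + My * norm1 ?k (\<lambda>i. z i - z' i)" using b(3) a(4) mono z by blast
  moreover have "\<bar>ip ?k \<sigma> (\<lambda>i. z' i - z i)\<bar> \<le> C * norm1 ?k (\<lambda>i. z' i - z i)"
    by (rule abs_ip_le) (use C[OF a(2)] in blast)
  moreover define \<epsilon> where "\<epsilon> = \<delta> / real (nst Q - 1)"
  ultimately show ?thesis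
    using a(1) b(1) unfolding norm1_minus_commute[of ?k z'] distrib_right \<epsilon>_def[symmetric] abs_le_iff by linarith
qed

text \<open>Infinitely many refinements with the same stage and states would give a sequence in the
  compact set \<open>adm Q d\<close> whose members keep a fixed distance.\<close>

lemma finitely_many_refinements:
  assumes finLC0: "\<forall>\<kappa> n. finite (LC0 \<kappa> n)" and "\<delta> > 0"
    and reach: "\<And>k. reach LC0 (LC k)"
    and mono: "\<And>k \<kappa> n. LC k \<kappa> n \<subseteq> LC (Suc k) \<kappa> n" "\<And>k \<kappa> n. UC k \<kappa> n \<subseteq> UC (Suc k) \<kappa> n"
  shows "finite {k. \<exists>z. refines_at \<delta> (LC k) (UC k) (LC (Suc k)) (UC (Suc k)) d l0 l m z}"
proof (rule ccontr)
  let ?r = "\<lambda>k z. refines_at \<delta> (LC k) (UC k) (LC (Suc k)) (UC (Suc k)) d l0 l m z"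
  assume inf: "infinite {k. \<exists>z. ?r k z}"
  let ?k = "dimy Q (d - 1)"
  have LCm: "LC i \<kappa> n \<subseteq> LC j \<kappa> n" and UCm: "UC i \<kappa> n \<subseteq> UC j \<kappa> n" if "i \<le> j" for i j \<kappa> n
    using lift_Suc_mono_le[of "\<lambda>k. LC k \<kappa> n", OF mono(1) that] lift_Suc_mono_le[of "\<lambda>k. UC k \<kappa> n", OF mono(2) that] by auto
  obtain k0 z0 where k0: "?r k0 z0" using inf not_finite_existsD by blast
  then have d: "d \<in> {2..nst Q}" unfolding refines_at_def by blast
  \<comment> \<open>A lower bound taken at the first refinement considered stays valid later, since
    more cuts only raise the value. This makes the slope bound \<open>C\<close> common to all
    refinements from \<open>k0\<close> on.\<close>
  obtain L where L: "\<And>z. ereal L \<le> LPval Q x (LC k0) d l m z" using k0 unfolding refines_at_def by blast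
  obtain C where C: "\<And>LC z \<sigma>. reach LC0 LC \<Longrightarrow> z \<in> adm Q d \<Longrightarrow> ereal L \<le> LPval Q x LC d l m z \<Longrightarrow>
     is_subgrad ?k (LPval Q x LC d l m) z \<sigma> \<Longrightarrow> \<forall>i<?k. \<bar>\<sigma> i\<bar> \<le> C"
    using cut_slopes_bounded[OF finLC0 d, of L l m] by blast
  define S where "S = {k. \<exists>z. ?r k z} - {..<k0}"
  have "infinite S" using inf by (simp add: S_def)
  from infinite_enumerate[OF this] obtain e :: "nat \<Rightarrow> nat" where e: "strict_mono e" "\<And>j. e j \<in> S" by blast
  have "\<forall>j. \<exists>z. ?r (e j) z" using e(2) unfolding S_def by blast
  then obtain z where "\<forall>j. ?r (e j) (z j)" unfolding choice_iff ..
  then have z: "?r (e j) (z j)" for j by blast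
  have sep: "\<delta> / real (nst Q - 1) < (C + My) * norm1 ?k (\<lambda>n. z i n - z j n)" if "i < j" for i j
  proof (rule refinements_separated[OF z z])
    have "Suc (e i) \<le> e j" using strict_monoD[OF e(1) that] by simp
    then show "LC (Suc (e i)) \<kappa> n \<subseteq> LC (e j) \<kappa> n" "UC (Suc (e i)) \<kappa> n \<subseteq> UC (e j) \<kappa> n" for \<kappa> n
      using LCm UCm by blast+
    have "k0 \<le> e i" using e(2)[of i] by (simp add: S_def)
    then have "LPval Q x (LC k0) d l m (z i) \<le> LPval Q x (LC (e i)) d l m (z i)"
      by (intro LPval_mono LCm)
    then have "ereal L \<le> LPval Q x (LC (e i)) d l m (z i)" using L order_trans by blast
    moreover have "z i \<in> adm Q d" using z[of i] unfolding refines_at_def by blast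
    ultimately show "is_subgrad ?k (LPval Q x (LC (e i)) d l m) (z i) \<sigma> \<Longrightarrow> \<forall>i<?k. \<bar>\<sigma> i\<bar> \<le> C" for \<sigma>
      using C[OF reach] by blast
  qed
  \<comment> \<open>The sign of \<open>C\<close> is unknown, hence the absolute value; adding 1
    makes the divisor positive.\<close>
  define \<epsilon> where "\<epsilon> = \<delta> / real (nst Q - 1) / (\<bar>C + My\<bar> + 1)"
  have pos: "\<delta> / real (nst Q - 1) > 0" using \<open>\<delta> > 0\<close> nst_ge_2 by simp
  then have "\<epsilon> > 0" unfolding \<epsilon>_def by (rule divide_pos_pos) simp
  obtain i j where ij: "i < j" "norm1 ?k (\<lambda>n. z i n - z j n) < \<epsilon>"
    using compact_ex_norm1_close[OF compact_adm[OF d] _ \<open>\<epsilon> > 0\<close>, of z ?k] z unfolding refines_at_def by blast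
  have "(C + My) * norm1 ?k (\<lambda>n. z i n - z j n) \<le> (\<bar>C + My\<bar> + 1) * norm1 ?k (\<lambda>n. z i n - z j n)"
    by (intro mult_right_mono norm1_nonneg) auto
  also have "\<dots> \<le> (\<bar>C + My\<bar> + 1) * \<epsilon>" using ij(2) by (intro mult_left_mono) auto
  also have "\<dots> = \<delta> / real (nst Q - 1)" by (simp add: \<epsilon>_def add_nonneg_eq_0_iff)
  finally show False using sep[OF ij(1)] by simp
qed

text \<open>A difference bounded by a real forces \<open>lo m\<close> to be finite, as subtracting
  minus infinity gives infinity. States of probability zero may keep infinite bounds, because 0
  times infinity is 0 in \<open>ereal\<close>.\<close>

lemma gap_le_of_statewise:
  assumes "\<And>m. p1 Q m > 0 \<Longrightarrow> up m - lo m \<le> ereal \<delta>" "\<And>m. lo m \<noteq> \<infinity>"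
  shows "upper_bound Q (LC, UC, lo, up) - lower_bound Q (LC, UC, lo, up) \<le> ereal \<delta>"
proof -
  have p1: "p1 Q m \<ge> 0" "(\<Sum>m\<in>UNIV. p1 Q m) = 1" for m using data by (auto simp: data_ok_def)
  define a where "a m = real_of_ereal (lo m)" for m
  have lo: "lo m = ereal (a m)" "up m \<le> ereal (a m + \<delta>)" if "p1 Q m > 0" for m
  proof -
    have g: "up m - lo m \<le> ereal \<delta>" using assms(1) that by blast
    then show 1: "lo m = ereal (a m)" using assms(2)[of m] by (cases "lo m") (auto simp: a_def)
    show "up m \<le> ereal (a m + \<delta>)" using g unfolding 1 by (cases "up m") auto
  qed
  have low: "ereal (p1 Q m) * lo m = ereal (p1 Q m * a m)" for m
    using p1(1)[of m] lo(1)[of m] by (cases "p1 Q m = 0") (auto simp: zero_ereal_def[symmetric])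
  have upp: "ereal (p1 Q m) * up m \<le> ereal (p1 Q m * (a m + \<delta>))" for m
  proof (cases "p1 Q m = 0")
    case False
    then have "p1 Q m > 0" using p1(1)[of m] by simp
    then show ?thesis using ereal_mult_left_mono[OF lo(2), of m "ereal (p1 Q m)"] by simp
  qed (simp add: zero_ereal_def[symmetric])
  have "(\<Sum>m\<in>UNIV. ereal (p1 Q m) * up m) \<le> (\<Sum>m\<in>UNIV. ereal (p1 Q m * (a m + \<delta>)))"
    by (intro sum_mono upp)
  also have "\<dots> = ereal ((\<Sum>m\<in>UNIV. p1 Q m * a m) + \<delta>)"
    using p1(2) by (simp add: distrib_left sum.distrib flip: sum_distrib_right)
  finally have "upper_bound Q (LC, UC, lo, up) \<le> ereal ((\<Sum>m\<in>UNIV. p1 Q m * a m) + \<delta>)"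
    by (simp add: upper_bound_def)
  moreover have "lower_bound Q (LC, UC, lo, up) = ereal (\<Sum>m\<in>UNIV. p1 Q m * a m)"
    by (simp add: lower_bound_def low)
  ultimately show ?thesis by (cases "upper_bound Q (LC, UC, lo, up)") auto
qed

lemma alg_terminates:
  assumes \<delta>: "\<delta> > 0" and fin: "\<forall>k n. finite (LC0 k n) \<and> finite (UC0 k n)"
    and init: "run 0 = initial_state LC0 UC0"
    and iter: "\<forall>k. alg_iter Q x My \<delta> (run k) (run (Suc k))"
  shows "\<exists>k\<ge>1. upper_bound Q (run k) - lower_bound Q (run k) \<le> ereal \<delta>"
proof -
  define LC UC lo up where "LC k = fst (run k)" and "UC k = fst (snd (run k))"
    and "lo k = fst (snd (snd (run k)))" and "up k = snd (snd (snd (run k)))" for k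
  have run: "run k = (LC k, UC k, lo k, up k)" for k
    by (simp add: LC_def UC_def lo_def up_def)
  have finLC0: "\<forall>\<kappa> n. finite (LC0 \<kappa> n)" using fin by blast
  have it: "alg_iter Q x My \<delta> (LC k, UC k, lo k, up k) (LC (Suc k), UC (Suc k), lo (Suc k), up (Suc k))" for k
    using iter run by metis
  have inv: "reach LC0 (LC k) \<and> (\<forall>\<kappa> n. finite (UC k \<kappa> n)) \<and> (\<forall>m. lo k m \<noteq> \<infinity>)" for k
  proof (induction k)
    case 0
    have "LC 0 = LC0" "UC 0 = UC0" "lo 0 = (\<lambda>_. - \<infinity>)"
      using init run[of 0] by (auto simp: initial_state_def)
    then show ?case using fin reach_init by simp
  next
    case (Suc k)
    then show ?case using alg_iter_cases[OF it finLC0, of k] by blast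
  qed
  note cases = alg_iter_cases[OF it finLC0 conjunct1[OF inv]]
  have step: "(\<forall>\<kappa> n. LC k \<kappa> n \<subseteq> LC (Suc k) \<kappa> n \<and> UC k \<kappa> n \<subseteq> UC (Suc k) \<kappa> n) \<and>
    ((\<exists>d l0 l m z. refines_at \<delta> (LC k) (UC k) (LC (Suc k)) (UC (Suc k)) d l0 l m z) \<or>
     (\<exists>m a b. p1 Q m > 0 \<and> (\<forall>m'. p1 Q m' > 0 \<longrightarrow> up k m' - lo k m' \<le> up k m - lo k m) \<and>
        lo (Suc k) = (lo k)(m := ereal a) \<and> up (Suc k) = (up k)(m := b) \<and> b \<le> ereal (a + \<delta>)))" for k
    using cases[of k] inv[of k] by blast
  let ?R = "\<lambda>d l0 l m. {k. \<exists>z. refines_at \<delta> (LC k) (UC k) (LC (Suc k)) (UC (Suc k)) d l0 l m z}"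
  have "finite (\<Union>d\<in>{2..nst Q}. \<Union>l0. \<Union>l. \<Union>m. ?R d l0 l m)"
  proof (intro finite_UN_I)
    show "finite (?R d l0 l m)" for d l0 l m
      by (rule finitely_many_refinements[OF finLC0 \<delta>]) (use inv step in blast)+
  qed simp_all
  then obtain N where N: "(\<Union>d\<in>{2..nst Q}. \<Union>l0. \<Union>l. \<Union>m. ?R d l0 l m) \<subseteq> {..<N}"
    unfolding finite_nat_iff_bounded ..
  have no_ref: "\<not> refines_at \<delta> (LC k) (UC k) (LC (Suc k)) (UC (Suc k)) d l0 l m z" if "k \<ge> N" for k d l0 l m z
  proof
    assume r: "refines_at \<delta> (LC k) (UC k) (LC (Suc k)) (UC (Suc k)) d l0 l m z"
    then have "d \<in> {2..nst Q}" unfolding refines_at_def by blast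
    then have "k \<in> {..<N}" using r by (intro subsetD[OF N]) blast
    then show False using that by simp
  qed
  \<comment> \<open>The states still blocking the stopping criterion; their number is the
    termination measure once refinements have ceased.\<close>
  define bad where "bad k = {m. p1 Q m > 0 \<and> \<not> up k m - lo k m \<le> ereal \<delta>}" for k
  have "\<exists>k'\<ge>k. bad k' = {}" if "k \<ge> N" for k
    using that
  proof (induction "card (bad k)" arbitrary: k rule: less_induct)
    case less
    show ?case
    proof (cases "bad k = {}")
      case False
      obtain m a b where m: "p1 Q m > 0" "\<And>m'. p1 Q m' > 0 \<Longrightarrow> up k m' - lo k m' \<le> up k m - lo k m"
        and new: "lo (Suc k) = (lo k)(m := ereal a)" "up (Suc k) = (up k)(m := b)" "b \<le> ereal (a + \<delta>)"
        using step[of k] no_ref[OF less.prems] by blast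
      \<comment> \<open>The selected state has the largest gap, so it is bad as soon as any state
        is. Updating it removes it from \<open>bad\<close>, and no other state changes.\<close>
      have "m \<in> bad k" using False m order_trans unfolding bad_def by blast
      have "b - ereal a \<le> ereal \<delta>" using new(3) by (cases b) auto
      then have "m \<notin> bad (Suc k)" by (simp add: bad_def new)
      moreover have "bad (Suc k) \<subseteq> insert m (bad k)" by (auto simp: bad_def new split: if_splits)
      ultimately have "bad (Suc k) \<subset> bad k" using \<open>m \<in> bad k\<close> by blast
      then have "card (bad (Suc k)) < card (bad k)" by (intro psubset_card_mono) simp_all
      from less.hyps[OF this] less.prems show ?thesis by (meson Suc_leD le_SucI)
    qed blast
  qed
  \<comment> \<open>The maximum with 1 ensures that at least one iteration has been carried
    out.\<close>
  from this[of "max N 1"] obtain k where k: "k \<ge> max N 1" "bad k = {}" by auto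
  then have "upper_bound Q (run k) - lower_bound Q (run k) \<le> ereal \<delta>"
    unfolding run by (intro gap_le_of_statewise) (use inv in \<open>auto simp: bad_def\<close>)
  then show ?thesis using k(1) by auto
qed

end

theorem theorem1:
  fixes Q :: "('s::finite, 'w::finite, 'x, 'b) msdata"
    and x :: 'x and My \<delta> :: real
    and LC0 :: "'s lcuts" and UC0 :: "'s ucuts"
    and run :: "nat \<Rightarrow> 's astate"
  assumes "data_ok Q"
    and "rel_complete_recourse Q x"
    and "bounded_subgradients Q x My"
    and "\<delta> > 0"
    and "\<forall>k n. finite (LC0 k n) \<and> finite (UC0 k n)"
    and "run 0 = initial_state LC0 UC0"
    and "\<forall>k. alg_iter Q x My \<delta> (run k) (run (Suc k))"
  shows "\<exists>k\<ge>1. upper_bound Q (run k) - lower_bound Q (run k) \<le> ereal \<delta>"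
proof -
  interpret multistage Q x My
    using assms(1-3) by unfold_locales
  show ?thesis
    using assms(4-7) by (rule alg_terminates)
qed

end
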